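(* The modal macro-micro BUG scheme (the rank-adaptive scheme with basis augmentation and asymptotic-preserving truncation, one step of which is written out in the context) is asymptotic-preserving in the following sense: in the limit $\varepsilon\to0$ it gives a consistent discretization of the diffusion equation $$\left(1+\frac{2a\Psi}{c_\nu}\right)\partial_t T=\frac{2ac}{3c_\nu}\,\partial_x\!\left(\frac{1}{\sigma^{a}}\,\Psi\,\partial_x T\right),\qquad \Psi=4T^{3}.$$
   Context: Parameters: $\varepsilon>0$, $c>0$ (speed of light), $a>0$ (radiation constant), $c_\nu>0$ (specific heat), $\kappa=2/c_\nu$. The absorption coefficient $\sigma^a(x)$ satisfies $\sigma^a(x)\ge\sigma_0>0$. Angular discretization: $N\ge1$ is an integer; $P_k$ is the $k$-th Legendre polynomial normalized in $L^2([-1,1])$; $\gamma_0=\sqrt2$, $\gamma_1=\sqrt{2/3}$; $(\mu_k,w_k)_{k=1}^{N+1}$ are the nodes and weights of the $(N+1)$-point Gauss-Legendre quadrature on $[-1,1]$. Let $\mathbf T\in\mathbb R^{N\times(N+1)}$ with $\mathbf T_{jk}=\sqrt{w_k}P_j(\mu_k)$, $j=1,\dots,N$, $\mathbf M=\mathrm{diag}(\mu_k)$, $|\mathbf M|=\mathrm{diag}(|\mu_k|)$, $\mathbf A^{\pm}=\frac12\mathbf T(\mathbf M\pm|\mathbf M|)\mathbf T^\top$, $\mathbf b=(\gamma_1,0,\dots,0)^\top\in\mathbb R^N$, and $\mathbf e_1=(1,0,\dots,0)^\top\in\mathbb R^N$. Grid: uniform staggered grid with $N_x$ cells, mesh width $\Delta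 x$, midpoints $x_i$ ($i=1,\dots,N_x$) and interfaces $x_{i+1/2}$; time step $\Delta t$. Temperature $T$ and mesoscopic variable $h$ (scalars) live at midpoints; the microscopic moments live at interfaces. $\sigma^a_i=\sigma^a(x_i)$, $\sigma^a_{i+1/2}=\sigma^a(x_{i+1/2})$, $\Psi^n_i=4(T^n_i)^3$, $\Psi^n_{i+1/2}=\frac12(\Psi^n_i+\Psi^n_{i+1})$. For interface functions $\mathcal D^-u_{i+1/2}=(u_{i+1/2}-u_{i-1/2})/\Delta x$, $\mathcal D^+u_{i+1/2}=(u_{i+3/2}-u_{i+1/2})/\Delta x$, $\mathcal D^0u_i=(u_{i+1/2}-u_{i-1/2})/\Delta x$; for midpoint functions $\delta^0u_{i+1/2}=(u_{i+1}-u_i)/\Delta x$. Boundary conditions are periodic (indices modulo $N_x$, interface index set $J=\{1,\dots,N_x\}$) or zero (interface quantities vanish at and outside the two boundary interfaces, $J=\{1,\dots,N_x-1\}$); sums over interfaces are over $J$. Low-rank representation: $\mathbf g^n=\mathbf X^n\mathbf S^n\mathbf V^{n,\top}\in\mathbb R^{|J|\times N}$ of current rank $r$ (with $2r+1\le\min(|J|,N)$), where $\mathbf X^n\in\mathbb R^{|J|\times r}$ and $\mathbf V^n\in\mathbb R^{N\times r}$ have orthonormal columns and $\mathbf S^n\in\mathbb R^{r\times r}$. The row with index $i$ of a spatial basis $\mathbf X$ is written $X^\top_{i+1/2}$. Abbreviate $s^n_{i+1/2}=ac\,\Psi^n_{i+1/2}\,\delta^0T^n_{i+1/2}+\varepsilon^2\delta^0h^n_{i+1/2}$,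 and let $\mathbf y^n\in\mathbb R^{|J|}$ have entries $y^n_{i+1/2}=(\sigma^a_{i+1/2})^{-1}\Psi^n_{i+1/2}\,\delta^0(ac\,T^n_{i+1/2})$. One step of the modal macro-micro BUG scheme, given $\mathbf X^n,\mathbf S^n,\mathbf V^n,h^n,T^n$: 1a. K-step: with $K^{n,\top}_{i+1/2}=X^{n,\top}_{i+1/2}\mathbf S^n$, solve $$\tfrac{\varepsilon^2}{c}\tfrac{K^{n+1}_{i+1/2}-K^n_{i+1/2}}{\Delta t}=-\varepsilon\left([\mathbf V^{n,\top}\mathbf A^+\mathbf V^n]\mathcal D^-K^n_{i+1/2}+[\mathbf V^{n,\top}\mathbf A^-\mathbf V^n]\mathcal D^+K^n_{i+1/2}\right)-\mathbf V^{n,\top}\mathbf b\,s^n_{i+1/2}-\sigma^a_{i+1/2}K^{n+1}_{i+1/2},$$ let $\mathbf K^{n+1}\in\mathbb R^{|J|\times r}$ have rows $K^{n+1,\top}_{i+1/2}$, and let $\widehat{\mathbf X}^{n+1}\in\mathbb R^{|J|\times(2r+1)}$ have orthonormal columns forming an orthonormal basis of $[\mathbf y^n\ \ \mathbf K^{n+1}\ \ \mathbf X^n]$ (its range contains these columns). 1b. L-step: with $\mathbf L^n=\mathbf V^n\mathbf S^{n,\top}$, solve $$\tfrac{\varepsilon^2}{c}\tfrac{\mathbf L^{n+1}-\mathbf L^n}{\Delta t}=-\varepsilon\left(\mathbf A^+\mathbf L^n\sum_i\mathcal D^-X^n_{i+1/2}X^{n,\top}_{i+1/2}+\mathbf A^-\mathbf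 L^n\sum_i\mathcal D^+X^n_{i+1/2}X^{n,\top}_{i+1/2}\right)-\mathbf b\sum_iX^{n,\top}_{i+1/2}s^n_{i+1/2}-\mathbf L^{n+1}\sum_i\sigma^a_{i+1/2}X^n_{i+1/2}X^{n,\top}_{i+1/2},$$ and let $\widehat{\mathbf V}^{n+1}\in\mathbb R^{N\times(2r+1)}$ have orthonormal columns forming an orthonormal basis of $[\mathbf b\ \ \mathbf L^{n+1}\ \ \mathbf V^n]$ (its range contains these columns), with first column $\mathbf b/\|\mathbf b\|$. 2. Galerkin step: with $\widetilde{\mathbf S}^n=\widehat{\mathbf X}^{n+1,\top}\mathbf X^n\,\mathbf S^n\,\mathbf V^{n,\top}\widehat{\mathbf V}^{n+1}$, find $\widehat{\mathbf S}^{n+1}\in\mathbb R^{(2r+1)\times(2r+1)}$ with $$\tfrac{\varepsilon^2}{c}\tfrac{\widehat{\mathbf S}^{n+1}-\widetilde{\mathbf S}^n}{\Delta t}=-\varepsilon\,\mathcal L_S\widetilde{\mathbf S}^n-\sum_i\widehat X^{n+1}_{i+1/2}s^n_{i+1/2}\,\mathbf b^\top\widehat{\mathbf V}^{n+1}-\sum_i\sigma^a_{i+1/2}\widehat X^{n+1}_{i+1/2}\widehat X^{n+1,\top}_{i+1/2}\widehat{\mathbf S}^{n+1},$$ $$\mathcal L_S\mathbf S=\sum_i\widehat X^{n+1}_{i+1/2}\mathcal D^-\widehat X^{n+1,\top}_{i+1/2}\mathbf S\widehat{\mathbf V}^{n+1,\top}\mathbf A^+\widehat{\mathbf V}^{n+1}+\sum_i\widehat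 X^{n+1}_{i+1/2}\mathcal D^+\widehat X^{n+1,\top}_{i+1/2}\mathbf S\widehat{\mathbf V}^{n+1,\top}\mathbf A^-\widehat{\mathbf V}^{n+1}.$$ 3. Splitting and truncation: set $\widehat{\mathbf K}=\widehat{\mathbf X}^{n+1}\widehat{\mathbf S}^{n+1}=[\widehat{\mathbf K}^{\rm ap}\ \ \widehat{\mathbf K}^{\rm rem}]$ and $\widehat{\mathbf V}^{n+1}=[\widehat{\mathbf V}^{\rm ap}\ \ \widehat{\mathbf V}^{\rm rem}]$, where "ap" denotes the first column (for $\widehat{\mathbf V}^{\rm ap}$: $\mathbf b/\|\mathbf b\|$) and "rem" the remaining $2r$ columns. Compute QR decompositions $\widehat{\mathbf K}^{\rm rem}=\widehat{\mathbf X}^{\rm rem}\widehat{\mathbf S}^{\rm rem}$ and $\widehat{\mathbf K}^{\rm ap}=\mathbf X^{\rm ap}\mathbf S^{\rm ap}$, and the SVD $\widehat{\mathbf S}^{\rm rem}=\mathbf U\boldsymbol\Sigma\mathbf W^\top$ with singular values $\hat\sigma_1\ge\dots\ge\hat\sigma_{2r}$. For a user tolerance $\vartheta$ choose $1\le r^*\le2r$ with $\big(\sum_{i=r^*+1}^{2r}\hat\sigma_i^2\big)^{1/2}\le\vartheta$; set $r_1=r^*+1$. Let $\widehat{\mathbf U},\widehat{\mathbf W}$ be the first $r^*$ columns of $\mathbf U,\mathbf W$ and $\widehat{\boldsymbol\Sigma}$ the leading $r^*\times r^*$ block of $\boldsymbol\Sigma$. Put $\mathbf X^{\rm rem}=\widehat{\mathbf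 X}^{\rm rem}\widehat{\mathbf U}$, $\mathbf S^{\rm rem}=\widehat{\boldsymbol\Sigma}$, $\mathbf V^{n+1}=[\widehat{\mathbf V}^{\rm ap}\ \ \widehat{\mathbf V}^{\rm rem}\widehat{\mathbf W}]\in\mathbb R^{N\times r_1}$; compute the QR decomposition $\mathbf X^{n+1}\mathbf R_2=[\mathbf X^{\rm ap}\ \ \mathbf X^{\rm rem}]$ with $\mathbf X^{n+1}\in\mathbb R^{|J|\times r_1}$; set $\mathbf S^{n+1}=\mathbf R_2\begin{bmatrix}\mathbf S^{\rm ap}&0\\0&\mathbf S^{\rm rem}\end{bmatrix}$ and $\mathbf g^{n+1}=\mathbf X^{n+1}\mathbf S^{n+1}\mathbf V^{n+1,\top}$. 4. Update of $h,T$: with $g^{n+1}_{1,i+1/2}=X^{n+1,\top}_{i+1/2}\mathbf S^{n+1}\mathbf V^{n+1,\top}\mathbf e_1$, $$\tfrac{\varepsilon^2}{c}\tfrac{h^{n+1}_i-h^n_i}{\Delta t}+a\kappa\sigma^a_i\Psi^n_ih^{n+1}_i+\tfrac{\gamma_1}{2}\mathcal D^0g^{n+1}_{1,i}=-\sigma^a_ih^{n+1}_i,\qquad \tfrac{T^{n+1}_i-T^n_i}{\Delta t}=\kappa\sigma^a_ih^{n+1}_i.$$ "In the limit $\varepsilon\to0$" means: keep only the $O(\varepsilon^0)$ terms of the scheme (i.e. set $\varepsilon=0$ in it). The resulting relations, after elimination of the microscopic quantities and $h^{n+1}$, form a recursion relating $T^{n+1}$ and $T^n$; it is a consistent discretization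 of the PDE if, when a smooth function $T(t,x)$ (with smooth $\sigma^a$) is inserted at interior grid points, the residual of the recursion (suitably scaled) converges to the residual of the PDE as $\Delta t,\Delta x\to0$. *)

theory Defs
  imports "HOL-Analysis.Analysis" "Jordan_Normal_Form.Matrix"
begin

section \<open>Legendre polynomials and Gauss-Legendre quadrature\<close>

text \<open>Rodrigues' formula, and the normalization in $L^2([-1,1])$.\<close>

definition legendre :: "nat \<Rightarrow> real poly" where
  "legendre k = Polynomial.smult (1 / (2 ^ k * fact k)) ((pderiv ^^ k) ([:-1, 0, 1:] ^ k))"

definition normalized_legendre :: "nat \<Rightarrow> real poly" where
  "normalized_legendre k = Polynomial.smult (sqrt ((2 * real k + 1) / 2)) (legendre k)"

text \<open>The nodes \<open>\<mu> 0, \<dots>, \<mu> (n - 1)\<close> enumerate the zeros of the \<open>n\<close>-th Legendre polynomial; the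
  weights are the integrals of the Lagrange basis polynomials.\<close>

definition gauss_legendre :: "nat \<Rightarrow> (nat \<Rightarrow> real) \<Rightarrow> (nat \<Rightarrow> real) \<Rightarrow> bool" where
  "gauss_legendre n \<mu> w \<longleftrightarrow>
     bij_betw \<mu> {..<n} {x. poly (legendre n) x = 0} \<and>
     (\<forall>k<n. w k = integral {-1..1} (\<lambda>x. \<Prod>j\<in>{..<n} - {k}. (x - \<mu> j) / (\<mu> k - \<mu> j)))"


section \<open>Parameters\<close>

datatype boundary = Periodic | Zero

record bug_params =
  eps :: real
  light :: real        \<comment> \<open>speed of light\<close>
  rad :: real          \<comment> \<open>radiation constant\<close>
  spec_heat :: real
  sigma_a :: "real \<Rightarrow> real"
  moments :: nat       \<comment> \<open>the \<open>N\<close> of the angular discretization\<close>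
  node :: "nat \<Rightarrow> real"
  weight :: "nat \<Rightarrow> real"
  bc :: boundary
  x_lo :: real
  x_hi :: real
  cells :: nat
  dt :: real
  tol :: real          \<comment> \<open>truncation tolerance\<close>

definition valid_params :: "bug_params \<Rightarrow> bool" where
  "valid_params P \<longleftrightarrow>
     0 < eps P \<and> 0 < light P \<and> 0 < rad P \<and> 0 < spec_heat P \<and>
     x_lo P < x_hi P \<and> 1 \<le> cells P \<and> 0 < dt P \<and> 0 \<le> tol P \<and>
     1 \<le> moments P \<and> gauss_legendre (moments P + 1) (node P) (weight P) \<and>
     (\<exists>\<sigma>0>0. \<forall>x\<in>{x_lo P..x_hi P}. \<sigma>0 \<le> sigma_a P x)"

definition kappa :: "bug_params \<Rightarrow> real" where
  "kappa P = 2 / spec_heat P"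

definition gamma1 :: real where
  "gamma1 = sqrt (2 / 3)"


section \<open>Angular matrices\<close>

text \<open>Matrix and vector indices start at 0, so row \<open>j\<close> belongs to the Legendre polynomial
  of degree \<open>j + 1\<close>.\<close>

definition T_mat :: "bug_params \<Rightarrow> real mat" where
  "T_mat P = mat (moments P) (moments P + 1)
     (\<lambda>(j, k). sqrt (weight P k) * poly (normalized_legendre (j + 1)) (node P k))"

definition M_mat :: "bug_params \<Rightarrow> real mat" where
  "M_mat P = mat_diag (moments P + 1) (node P)"

definition absM_mat :: "bug_params \<Rightarrow> real mat" where
  "absM_mat P = mat_diag (moments P + 1) (\<lambda>k. \<bar>node P k\<bar>)"

definition A_plus :: "bug_params \<Rightarrow> real mat" where
  "A_plus P = (1 / 2) \<cdot>\<^sub>m (T_mat P * (M_mat P + absM_mat P) * transpose_mat (T_mat P))"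

definition A_minus :: "bug_params \<Rightarrow> real mat" where
  "A_minus P = (1 / 2) \<cdot>\<^sub>m (T_mat P * (M_mat P - absM_mat P) * transpose_mat (T_mat P))"

definition b_vec :: "bug_params \<Rightarrow> real vec" where
  "b_vec P = gamma1 \<cdot>\<^sub>v unit_vec (moments P) 0"


section \<open>Staggered grid\<close>

text \<open>Everything is counted from 0: the cells are \<open>0, \<dots>, cells P - 1\<close>, and interface \<open>i\<close> is the
  right interface of cell \<open>i\<close>. Hence the cell and the interface with number \<open>i\<close> are the ones usually
  written with indices \<open>i + 1\<close> and \<open>i + 3/2\<close>. The unknown interface values are those
  with number \<open>i < faces P\<close>; \<open>face_ext\<close> extends them to all integers.\<close>

definition dx :: "bug_params \<Rightarrow> real" where
  "dx P = (x_hi P - x_lo P) / real (cells P)"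

definition x_cell :: "bug_params \<Rightarrow> nat \<Rightarrow> real" where
  "x_cell P i = x_lo P + (real i + 1 / 2) * dx P"

definition x_face :: "bug_params \<Rightarrow> nat \<Rightarrow> real" where
  "x_face P i = x_lo P + (real i + 1) * dx P"

definition faces :: "bug_params \<Rightarrow> nat" where
  "faces P = (case bc P of Periodic \<Rightarrow> cells P | Zero \<Rightarrow> cells P - 1)"

definition face_ext :: "bug_params \<Rightarrow> (nat \<Rightarrow> real) \<Rightarrow> int \<Rightarrow> real" where
  "face_ext P u i = (case bc P of
       Periodic \<Rightarrow> u (nat (i mod int (cells P)))
     | Zero \<Rightarrow> if 0 \<le> i \<and> i < int (faces P) then u (nat i) else 0)"

definition D0 :: "bug_params \<Rightarrow> (nat \<Rightarrow> real) \<Rightarrow> nat \<Rightarrow> real" where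
  "D0 P u i = (face_ext P u (int i) - face_ext P u (int i - 1)) / dx P"

text \<open>The one-sided differences, applied to every column of a matrix whose rows are indexed by
  the interfaces.\<close>

definition D_minus :: "bug_params \<Rightarrow> real mat \<Rightarrow> real mat" where
  "D_minus P X = mat (dim_row X) (dim_col X) (\<lambda>(i, k).
     (face_ext P (\<lambda>j. X $$ (j, k)) (int i) - face_ext P (\<lambda>j. X $$ (j, k)) (int i - 1)) / dx P)"

definition D_plus :: "bug_params \<Rightarrow> real mat \<Rightarrow> real mat" where
  "D_plus P X = mat (dim_row X) (dim_col X) (\<lambda>(i, k).
     (face_ext P (\<lambda>j. X $$ (j, k)) (int i + 1) - face_ext P (\<lambda>j. X $$ (j, k)) (int i)) / dx P)"

definition delta0 :: "bug_params \<Rightarrow> (nat \<Rightarrow> real) \<Rightarrow> nat \<Rightarrow> real" where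
  "delta0 P u i = (u (Suc i mod cells P) - u i) / dx P"

definition Psi :: "(nat \<Rightarrow> real) \<Rightarrow> nat \<Rightarrow> real" where
  "Psi T i = 4 * T i ^ 3"

definition Psi_face :: "bug_params \<Rightarrow> (nat \<Rightarrow> real) \<Rightarrow> nat \<Rightarrow> real" where
  "Psi_face P T i = (Psi T i + Psi T (Suc i mod cells P)) / 2"

definition sigma_cell :: "bug_params \<Rightarrow> nat \<Rightarrow> real" where
  "sigma_cell P i = sigma_a P (x_cell P i)"

definition sigma_face :: "bug_params \<Rightarrow> nat \<Rightarrow> real" where
  "sigma_face P i = sigma_a P (x_face P i)"

definition sigma_mat :: "bug_params \<Rightarrow> real mat" where
  "sigma_mat P = mat_diag (faces P) (sigma_face P)"

definition s_vec :: "bug_params \<Rightarrow> (nat \<Rightarrow> real) \<Rightarrow> (nat \<Rightarrow> real) \<Rightarrow> real vec" where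
  "s_vec P h T = vec (faces P)
     (\<lambda>i. rad P * light P * Psi_face P T i * delta0 P T i + (eps P)\<^sup>2 * delta0 P h i)"

definition y_face :: "bug_params \<Rightarrow> (nat \<Rightarrow> real) \<Rightarrow> nat \<Rightarrow> real" where
  "y_face P T i =
     inverse (sigma_face P i) * Psi_face P T i * delta0 P (\<lambda>j. rad P * light P * T j) i"

definition y_vec :: "bug_params \<Rightarrow> (nat \<Rightarrow> real) \<Rightarrow> real vec" where
  "y_vec P T = vec (faces P) (y_face P T)"


section \<open>Matrix notions\<close>

definition outer :: "real vec \<Rightarrow> real vec \<Rightarrow> real mat" where
  "outer u v = mat (dim_vec u) (dim_vec v) (\<lambda>(i, j). u $ i * v $ j)"

definition orthonormal_cols :: "real mat \<Rightarrow> bool" where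
  "orthonormal_cols Q \<longleftrightarrow> transpose_mat Q * Q = 1\<^sub>m (dim_col Q)"

text \<open>Every column of \<open>B\<close> lies in the range of \<open>Q\<close>.\<close>

definition range_contains :: "real mat \<Rightarrow> real mat \<Rightarrow> bool" where
  "range_contains Q B \<longleftrightarrow> (\<exists>C \<in> carrier_mat (dim_col Q) (dim_col B). B = Q * C)"

definition col_mat :: "real vec \<Rightarrow> real mat" where
  "col_mat v = mat_of_cols (dim_vec v) [v]"

text \<open>The \<open>m\<close> columns of \<open>A\<close> that start at column \<open>k\<close>, and the juxtaposition of two matrices.\<close>

definition col_block :: "nat \<Rightarrow> nat \<Rightarrow> real mat \<Rightarrow> real mat" where
  "col_block k m A = mat (dim_row A) m (\<lambda>(i, j). A $$ (i, k + j))"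

definition append_cols :: "real mat \<Rightarrow> real mat \<Rightarrow> real mat" where
  "append_cols A B = mat (dim_row A) (dim_col A + dim_col B)
     (\<lambda>(i, j). if j < dim_col A then A $$ (i, j) else B $$ (i, j - dim_col A))"

definition is_QR :: "real mat \<Rightarrow> real mat \<Rightarrow> real mat \<Rightarrow> bool" where
  "is_QR A Q R \<longleftrightarrow>
     Q \<in> carrier_mat (dim_row A) (dim_col A) \<and> R \<in> carrier_mat (dim_col A) (dim_col A) \<and>
     orthonormal_cols Q \<and> upper_triangular R \<and> A = Q * R"

text \<open>Singular value decomposition of a square matrix of size \<open>n\<close> with singular values
  \<open>sv 0 \<ge> \<dots> \<ge> sv (n - 1) \<ge> 0\<close>.\<close>

definition is_SVD :: "nat \<Rightarrow> real mat \<Rightarrow> real mat \<Rightarrow> (nat \<Rightarrow> real) \<Rightarrow> real mat \<Rightarrow> bool" where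
  "is_SVD n A U sv W \<longleftrightarrow>
     U \<in> carrier_mat n n \<and> W \<in> carrier_mat n n \<and> orthonormal_cols U \<and> orthonormal_cols W \<and>
     (\<forall>i<n. 0 \<le> sv i) \<and> (\<forall>i j. i \<le> j \<longrightarrow> j < n \<longrightarrow> sv j \<le> sv i) \<and>
     A = U * mat_diag n sv * transpose_mat W"


section \<open>One step of the modal macro-micro BUG scheme\<close>

definition low_rank :: "bug_params \<Rightarrow> nat \<Rightarrow> real mat \<Rightarrow> real mat \<Rightarrow> real mat \<Rightarrow> bool" where
  "low_rank P r X S V \<longleftrightarrow>
     1 \<le> r \<and> 2 * r + 1 \<le> min (faces P) (moments P) \<and>
     X \<in> carrier_mat (faces P) r \<and> S \<in> carrier_mat r r \<and> V \<in> carrier_mat (moments P) r \<and>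
     orthonormal_cols X \<and> orthonormal_cols V"

text \<open>Sums over the interfaces are matrix products: the sum of \<open>\<^bold>x\<^sub>i \<^bold>z\<^sub>i\<^sup>T\<close>, where \<open>\<^bold>x\<^sub>i\<^sup>T\<close> and
  \<open>\<^bold>z\<^sub>i\<^sup>T\<close> are the rows of \<open>X\<close> and \<open>Z\<close>, is \<open>X\<^sup>T Z\<close>. The K-step equation is the transpose of the
  equation for the columns \<open>K\<^sub>i\<close>, one row for each interface.\<close>

definition K_step :: "bug_params \<Rightarrow> real mat \<Rightarrow> real mat \<Rightarrow> real mat \<Rightarrow> (nat \<Rightarrow> real) \<Rightarrow>
    (nat \<Rightarrow> real) \<Rightarrow> real mat \<Rightarrow> bool" where
  "K_step P X S V h T K' \<longleftrightarrow>
     (let K = X * S; r = dim_col V; Vt = transpose_mat V in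
      K' \<in> carrier_mat (faces P) r \<and>
      ((eps P)\<^sup>2 / light P / dt P) \<cdot>\<^sub>m (K' - K) =
        (- eps P) \<cdot>\<^sub>m (D_minus P K * transpose_mat (Vt * A_plus P * V)
                     + D_plus P K * transpose_mat (Vt * A_minus P * V))
        - outer (s_vec P h T) (Vt *\<^sub>v b_vec P)
        - sigma_mat P * K')"

definition L_step :: "bug_params \<Rightarrow> real mat \<Rightarrow> real mat \<Rightarrow> real mat \<Rightarrow> (nat \<Rightarrow> real) \<Rightarrow>
    (nat \<Rightarrow> real) \<Rightarrow> real mat \<Rightarrow> bool" where
  "L_step P X S V h T L' \<longleftrightarrow>
     (let L = V * transpose_mat S; r = dim_col V; Xt = transpose_mat X in
      L' \<in> carrier_mat (moments P) r \<and>
      ((eps P)\<^sup>2 / light P / dt P) \<cdot>\<^sub>m (L' - L) =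
        (- eps P) \<cdot>\<^sub>m (A_plus P * L * (transpose_mat (D_minus P X) * X)
                     + A_minus P * L * (transpose_mat (D_plus P X) * X))
        - outer (b_vec P) (Xt *\<^sub>v s_vec P h T)
        - L' * (Xt * sigma_mat P * X))"

definition augment_X :: "bug_params \<Rightarrow> real mat \<Rightarrow> (nat \<Rightarrow> real) \<Rightarrow> real mat \<Rightarrow> real mat \<Rightarrow> bool" where
  "augment_X P X T K' Xh \<longleftrightarrow>
     Xh \<in> carrier_mat (faces P) (2 * dim_col X + 1) \<and> orthonormal_cols Xh \<and>
     range_contains Xh (append_cols (append_cols (col_mat (y_vec P T)) K') X)"

definition augment_V :: "bug_params \<Rightarrow> real mat \<Rightarrow> real mat \<Rightarrow> real mat \<Rightarrow> bool" where
  "augment_V P V L' Vh \<longleftrightarrow>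
     Vh \<in> carrier_mat (moments P) (2 * dim_col V + 1) \<and> orthonormal_cols Vh \<and>
     range_contains Vh (append_cols (append_cols (col_mat (b_vec P)) L') V) \<and>
     col Vh 0 = (1 / sqrt (scalar_prod (b_vec P) (b_vec P))) \<cdot>\<^sub>v b_vec P"

definition L_S :: "bug_params \<Rightarrow> real mat \<Rightarrow> real mat \<Rightarrow> real mat \<Rightarrow> real mat" where
  "L_S P Xh Vh S =
     transpose_mat Xh * D_minus P Xh * S * (transpose_mat Vh * A_plus P * Vh) +
     transpose_mat Xh * D_plus P Xh * S * (transpose_mat Vh * A_minus P * Vh)"

definition galerkin_step :: "bug_params \<Rightarrow> real mat \<Rightarrow> real mat \<Rightarrow> real mat \<Rightarrow> (nat \<Rightarrow> real) \<Rightarrow>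
    (nat \<Rightarrow> real) \<Rightarrow> real mat \<Rightarrow> real mat \<Rightarrow> real mat \<Rightarrow> bool" where
  "galerkin_step P X S V h T Xh Vh Sh \<longleftrightarrow>
     (let m = 2 * dim_col X + 1; Xht = transpose_mat Xh;
          St = Xht * X * S * (transpose_mat V * Vh) in
      Sh \<in> carrier_mat m m \<and>
      ((eps P)\<^sup>2 / light P / dt P) \<cdot>\<^sub>m (Sh - St) =
        (- eps P) \<cdot>\<^sub>m L_S P Xh Vh St
        - outer (Xht *\<^sub>v s_vec P h T) (transpose_mat Vh *\<^sub>v b_vec P)
        - Xht * sigma_mat P * Xh * Sh)"

definition truncation :: "bug_params \<Rightarrow> nat \<Rightarrow> real mat \<Rightarrow> real mat \<Rightarrow> real mat \<Rightarrow>
    nat \<Rightarrow> real mat \<Rightarrow> real mat \<Rightarrow> real mat \<Rightarrow> bool" where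
  "truncation P r Xh Sh Vh r1 X1 S1 V1 \<longleftrightarrow>
     (let Kh = Xh * Sh; K_ap = col_block 0 1 Kh; K_rem = col_block 1 (2 * r) Kh;
          V_ap = col_block 0 1 Vh; V_rem = col_block 1 (2 * r) Vh in
      \<exists>Xh_rem Sh_rem X_ap S_ap U sv W rs R2.
        is_QR K_rem Xh_rem Sh_rem \<and> is_QR K_ap X_ap S_ap \<and> is_SVD (2 * r) Sh_rem U sv W \<and>
        1 \<le> rs \<and> rs \<le> 2 * r \<and> sqrt (\<Sum>i\<in>{rs..<2 * r}. (sv i)\<^sup>2) \<le> tol P \<and>
        r1 = rs + 1 \<and>
        V1 = append_cols V_ap (V_rem * col_block 0 rs W) \<and>
        is_QR (append_cols X_ap (Xh_rem * col_block 0 rs U)) X1 R2 \<and>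
        S1 = R2 * four_block_mat S_ap (0\<^sub>m 1 rs) (0\<^sub>m rs 1) (mat_diag rs sv))"

definition macro_update :: "bug_params \<Rightarrow> real mat \<Rightarrow> (nat \<Rightarrow> real) \<Rightarrow> (nat \<Rightarrow> real) \<Rightarrow>
    (nat \<Rightarrow> real) \<Rightarrow> (nat \<Rightarrow> real) \<Rightarrow> bool" where
  "macro_update P g' h T h' T' \<longleftrightarrow>
     (\<forall>i<cells P.
        (eps P)\<^sup>2 / light P * ((h' i - h i) / dt P)
          + rad P * kappa P * sigma_cell P i * Psi T i * h' i
          + gamma1 / 2 * D0 P (\<lambda>j. (g' *\<^sub>v unit_vec (moments P) 0) $ j) i
          = - sigma_cell P i * h' i \<and>
        (T' i - T i) / dt P = kappa P * sigma_cell P i * h' i)"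

text \<open>The step takes \<open>(r, X, S, V, h, T)\<close> to \<open>(r', X', S', V', h', T')\<close>. It is a relation, since
  the orthonormal bases, the decompositions and the new rank are not unique.\<close>

definition bug_step :: "bug_params \<Rightarrow>
    nat \<Rightarrow> real mat \<Rightarrow> real mat \<Rightarrow> real mat \<Rightarrow> (nat \<Rightarrow> real) \<Rightarrow> (nat \<Rightarrow> real) \<Rightarrow>
    nat \<Rightarrow> real mat \<Rightarrow> real mat \<Rightarrow> real mat \<Rightarrow> (nat \<Rightarrow> real) \<Rightarrow> (nat \<Rightarrow> real) \<Rightarrow> bool" where
  "bug_step P r X S V h T r' X' S' V' h' T' \<longleftrightarrow>
     (\<exists>K' Xh L' Vh Sh.
        K_step P X S V h T K' \<and> augment_X P X T K' Xh \<and>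
        L_step P X S V h T L' \<and> augment_V P V L' Vh \<and>
        galerkin_step P X S V h T Xh Vh Sh \<and>
        truncation P r Xh Sh Vh r' X' S' V' \<and>
        macro_update P (X' * S' * transpose_mat V') h T h' T')"


section \<open>Limit recursion and consistency\<close>

text \<open>Left-hand side minus right-hand side of the recursion relating \<open>T' = T\<^sup>n\<^sup>+\<^sup>1\<close> and
  \<open>T = T\<^sup>n\<close>, in the scaling of the diffusion equation. The factor \<open>2 / (3 spec_heat)\<close>
  is \<open>kappa gamma1\<^sup>2 / 2\<close>; the factor \<open>rad light\<close> of the flux is part of \<open>y_face\<close>.\<close>

definition limit_residual :: "bug_params \<Rightarrow> (nat \<Rightarrow> real) \<Rightarrow> (nat \<Rightarrow> real) \<Rightarrow> nat \<Rightarrow> real" where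
  "limit_residual P T T' i =
     (1 + 2 * rad P * Psi T i / spec_heat P) * ((T' i - T i) / dt P)
       - 2 / (3 * spec_heat P) * D0 P (y_face P T) i"

definition diffusion_residual :: "bug_params \<Rightarrow> (real \<times> real \<Rightarrow> real) \<Rightarrow> real \<Rightarrow> real \<Rightarrow> real" where
  "diffusion_residual P T t x =
     (1 + 2 * rad P * (4 * T (t, x) ^ 3) / spec_heat P) * deriv (\<lambda>s. T (s, x)) t
       - 2 * rad P * light P / (3 * spec_heat P) *
         deriv (\<lambda>y. 1 / sigma_a P y * (4 * T (t, y) ^ 3) * deriv (\<lambda>z. T (t, z)) y) x"

text \<open>\<open>C\<^sup>k\<close> functions on an open set.\<close>

primrec Ck_on :: "nat \<Rightarrow> ('a::euclidean_space \<Rightarrow> real) \<Rightarrow> 'a set \<Rightarrow> bool" where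
  "Ck_on 0 f U \<longleftrightarrow> continuous_on U f"
| "Ck_on (Suc k) f U \<longleftrightarrow>
     (\<exists>D. (\<forall>x\<in>U. (f has_derivative D x) (at x)) \<and> (\<forall>v. Ck_on k (\<lambda>x. D x v) U))"

definition smooth_near :: "('a::euclidean_space \<Rightarrow> real) \<Rightarrow> 'a set \<Rightarrow> bool" where
  "smooth_near f A \<longleftrightarrow> (\<exists>U. open U \<and> A \<subseteq> U \<and> (\<forall>k. Ck_on k f U))"

text \<open>Consistency of a recursion with residual \<open>Res\<close>: for smooth \<open>\<sigma>\<^sup>a\<close> and every smooth \<open>T\<close>, the
  residual of the recursion converges to that of the diffusion equation, uniformly over the
  interior cells and the time levels, as \<open>dt\<close> and \<open>dx\<close> tend to 0 independently.\<close>

definition consistent_with_diffusion ::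
    "bug_params \<Rightarrow> (bug_params \<Rightarrow> (nat \<Rightarrow> real) \<Rightarrow> (nat \<Rightarrow> real) \<Rightarrow> nat \<Rightarrow> real) \<Rightarrow> bool" where
  "consistent_with_diffusion P Res \<longleftrightarrow>
     (smooth_near (sigma_a P) {x_lo P..x_hi P} \<longrightarrow>
      (\<forall>T t0 t1. smooth_near T ({t0..t1} \<times> {x_lo P..x_hi P}) \<longrightarrow>
        (\<forall>e>0. \<exists>d>0. \<forall>\<tau> n t i.
           (let Q = P\<lparr>cells := n, dt := \<tau>\<rparr> in
            0 < \<tau> \<longrightarrow> \<tau> < d \<longrightarrow> dx Q < d \<longrightarrow> t0 \<le> t \<longrightarrow> t + \<tau> \<le> t1 \<longrightarrow> 0 < i \<longrightarrow> Suc i < n \<longrightarrow>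
            \<bar>Res Q (\<lambda>j. T (t, x_cell Q j)) (\<lambda>j. T (t + \<tau>, x_cell Q j)) i
              - diffusion_residual P T t (x_cell Q i)\<bar> < e))))"

end

theory Submission
  imports Defs "Jordan_Normal_Form.Determinant"
begin

text \<open>For \<open>\<epsilon> = 0\<close> the K-step and the L-step are decoupled linear equations, and the coefficients of
  the Galerkin step solve a weighted least squares problem whose right-hand side is the weighted
  projection of \<open>\<^bold>y \<^bold>b\<^sup>T\<close>. As the augmented bases contain \<open>\<^bold>y\<close> and \<open>\<^bold>b\<close>, the solution is exact: it
  represents \<open>- \<^bold>y \<^bold>b\<^sup>T\<close>. Since \<open>\<^bold>b\<close> spans the first column of the angular basis, all other columns
  of \<open>\<^bold>K\<close> vanish and the truncation loses nothing. Hence the first moment is \<open>- \<gamma>\<^sub>1 \<^bold>y\<close>, and the macroscopic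
  update becomes the explicit three-point scheme for the diffusion equation. Its consistency is
  uniform because the mean value theorem turns every difference quotient into a derivative at a
  nearby point, and a single continuous function on a compact box controls the error.\<close>

section \<open>QR decompositions\<close>

text \<open>A Gram-Schmidt step that cannot break down: if \<open>v\<close> already lies in the span
  of the \<open>q k\<close>, then \<open>c = 0\<close> and \<open>u\<close> is any unit vector
  orthogonal to them, which exists because \<open>m < n\<close>. Degenerate input does occur: for
  \<epsilon> = 0 the columns of the K-step solution are multiples of y, so the matrix that is
  augmented is rank deficient.\<close>

lemma orthonormal_extend:
  fixes q :: "nat \<Rightarrow> nat \<Rightarrow> real" and v :: "nat \<Rightarrow> real"
  assumes on: "\<And>j k. j < m \<Longrightarrow> k < m \<Longrightarrow> (\<Sum>i<n. q j i * q k i) = (if j = k then 1 else 0)"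
    and "m < n"
  shows "\<exists>u c. 0 \<le> c \<and> (\<Sum>i<n. u i * u i) = 1 \<and> (\<forall>k<m. (\<Sum>i<n. q k i * u i) = 0) \<and>
    (\<forall>i<n. v i = (\<Sum>k<m. (\<Sum>i<n. q k i * v i) * q k i) + c * u i)"
proof -
  \<comment> \<open>\<open>p w\<close> is the residual of \<open>w\<close> after orthogonal
    projection onto the span of the \<open>q k\<close>.\<close>
  define p where "p w i = w i - (\<Sum>k<m. (\<Sum>i<n. q k i * w i) * q k i)" for w i
  have orth: "(\<Sum>i<n. q l i * p w i) = 0" if "l < m" for l w
  proof -
    have "(\<Sum>i<n. q l i * p w i) = (\<Sum>i<n. q l i * w i)
        - (\<Sum>i<n. \<Sum>k<m. (\<Sum>i<n. q k i * w i) * (q l i * q k i))"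
      by (simp add: p_def right_diff_distrib sum_subtractf sum_distrib_left mult_ac)
    also have "(\<Sum>i<n. \<Sum>k<m. (\<Sum>i<n. q k i * w i) * (q l i * q k i))
        = (\<Sum>k<m. (\<Sum>i<n. q k i * w i) * (\<Sum>i<n. q l i * q k i))"
      by (subst sum.swap) (simp add: sum_distrib_left)
    also have "\<dots> = (\<Sum>k<m. if k = l then (\<Sum>i<n. q k i * w i) else 0)"
      by (rule sum.cong) (use that on in auto)
    also have "\<dots> = (\<Sum>i<n. q l i * w i)" using that by simp
    finally show ?thesis by simp
  qed
  \<comment> \<open>Any vector with nonzero residual yields a suitable \<open>u\<close> by
    normalization. This is applied to \<open>v\<close> if possible and otherwise to a standard basis
    vector outside the span.\<close>
  have norm: "\<exists>u c. 0 \<le> c \<and> (\<Sum>i<n. u i * u i) = 1 \<and> (\<forall>k<m. (\<Sum>i<n. q k i * u i) = 0) \<and>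
      (\<forall>i<n. p w i = c * u i)" if "i0 < n" "p w i0 \<noteq> 0" for w i0
  proof -
    define c where "c = sqrt (\<Sum>i<n. p w i * p w i)"
    have pos: "0 < (\<Sum>i<n. p w i * p w i)"
      by (rule sum_pos2[of _ i0]) (use that in \<open>auto simp: zero_less_mult_iff\<close>)
    then have c: "0 < c" "c * c = (\<Sum>i<n. p w i * p w i)" by (auto simp: c_def)
    show ?thesis
    proof (intro exI conjI allI impI)
      show "0 \<le> c" using c by simp
      have "(\<Sum>i<n. p w i / c * (p w i / c)) = (\<Sum>i<n. p w i * p w i) / (c * c)"
        by (simp add: sum_divide_distrib)
      then show "(\<Sum>i<n. p w i / c * (p w i / c)) = 1" using c pos by simp
      show "(\<Sum>i<n. q k i * (p w i / c)) = 0" if "k < m" for k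
        using orth[OF that, of w] by (simp flip: sum_divide_distrib)
      show "p w i = c * (p w i / c)" for i using c by simp
    qed
  qed
  show ?thesis
  proof (cases "\<exists>i<n. p v i \<noteq> 0")
    case True
    then obtain i0 where "i0 < n" "p v i0 \<noteq> 0" by blast
    from norm[OF this] obtain u c where "0 \<le> c" "(\<Sum>i<n. u i * u i) = 1"
      "\<forall>k<m. (\<Sum>i<n. q k i * u i) = 0" and pv: "\<forall>i<n. p v i = c * u i" by blast
    moreover have "\<forall>i<n. v i = (\<Sum>k<m. (\<Sum>i<n. q k i * v i) * q k i) + c * u i"
    proof (intro allI impI)
      fix i assume "i < n"
      with pv have "p v i = c * u i" by blast
      then show "v i = (\<Sum>k<m. (\<Sum>i<n. q k i * v i) * q k i) + c * u i"
        unfolding p_def by linarith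
    qed
    ultimately show ?thesis by blast
  next
    case v: False
    have "\<exists>i<n. p (\<lambda>j. if j = i then 1 else 0) i \<noteq> 0"
    proof (rule ccontr)
      txt \<open>Otherwise the orthogonal projection onto the span, whose trace is \<open>m\<close>, would be the
        identity, whose trace is \<open>n\<close>.\<close>
      assume "\<not> ?thesis"
      then have one: "(\<Sum>k<m. q k i * q k i) = 1" if "i < n" for i
        using that by (auto simp: p_def if_distrib[of "\<lambda>x. _ * x"] cong: if_cong)
      have "real n = (\<Sum>i<n. \<Sum>k<m. q k i * q k i)" using one by simp
      also have "\<dots> = (\<Sum>k<m. \<Sum>i<n. q k i * q k i)" by (rule sum.swap)
      also have "\<dots> = real m" by (simp add: on)
      finally show False using \<open>m < n\<close> by simp
    qed
    then obtain i0 where "i0 < n" "p (\<lambda>j. if j = i0 then 1 else 0) i0 \<noteq> 0" by blast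
    from norm[OF this] obtain u where u: "(\<Sum>i<n. u i * u i) = 1"
      "\<forall>k<m. (\<Sum>i<n. q k i * u i) = 0" by blast
    have "\<forall>i<n. v i = (\<Sum>k<m. (\<Sum>i<n. q k i * v i) * q k i) + 0 * u i"
      using v by (auto simp: p_def)
    with u show ?thesis by (intro exI[of _ u] exI[of _ 0]) auto
  qed
qed

text \<open>Columns are functions, with the column index first, so that the induction appends a
  column by a function update. The sign condition on the diagonal of \<open>R\<close> later fixes
  the orientation of the first angular basis vector.\<close>

lemma gram_schmidt_functions:
  fixes a :: "nat \<Rightarrow> nat \<Rightarrow> real"
  assumes "m \<le> n"
  shows "\<exists>q R. (\<forall>j<m. \<forall>k<m. (\<Sum>i<n. q j i * q k i) = (if j = k then 1 else 0)) \<and>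
    (\<forall>j<m. \<forall>i<n. a j i = (\<Sum>k<m. q k i * R k j)) \<and>
    (\<forall>j<m. 0 \<le> R j j \<and> (\<forall>k. j < k \<longrightarrow> R k j = (0::real)))"
  using assms
proof (induction m)
  case 0
  show ?case by simp
next
  case (Suc m)
  then have "m \<le> n" by simp
  from Suc.IH[OF this] obtain q R
    where raw: "\<forall>j<m. \<forall>k<m. (\<Sum>i<n. q j i * q k i) = (if j = k then 1 else 0)"
    "\<forall>j<m. \<forall>i<n. a j i = (\<Sum>k<m. q k i * R k j)"
    "\<forall>j<m. 0 \<le> R j j \<and> (\<forall>k. j < k \<longrightarrow> R k j = (0::real))" by (elim exE conjE)
  have on: "(\<Sum>i<n. q j i * q k i) = (if j = k then 1 else 0)" if "j < m" "k < m" for j k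
    using raw(1) that by blast
  have a: "a j i = (\<Sum>k<m. q k i * R k j)" if "j < m" "i < n" for j i
    using raw(2) that by blast
  have R: "0 \<le> R j j" "j < k \<Longrightarrow> R k j = 0" if "j < m" for j k
    using raw(3) that by blast+
  from Suc.prems have "m < n" by simp
  from orthonormal_extend[OF on this, of "a m"] obtain u c where "0 \<le> c"
    and uu: "(\<Sum>i<n. u i * u i) = 1" and qu: "\<And>k. k < m \<Longrightarrow> (\<Sum>i<n. q k i * u i) = 0"
    and am: "\<And>i. i < n \<Longrightarrow> a m i = (\<Sum>k<m. (\<Sum>i<n. q k i * a m i) * q k i) + c * u i"
    by blast
  have uq: "(\<Sum>i<n. u i * q k i) = 0" if "k < m" for k
    using qu[OF that] by (simp add: mult.commute)
  \<comment> \<open>Column \<open>m\<close> collects the projection coefficients with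
    \<open>c\<close> on the diagonal. Earlier columns are kept; their new entry in row
    \<open>m\<close> vanishes because the induction hypothesis gives zeros for every
    \<open>k > j\<close>, without the bound \<open>k < m\<close>.\<close>
  define R' where "R' k j = (if j = m then if k < m then \<Sum>i<n. q k i * a m i
    else if k = m then c else 0 else R k j)" for k j
  show ?case
  proof (rule exI[of _ "q(m := u)"], rule exI[of _ R'], intro conjI allI impI)
    fix j k assume "j < Suc m" "k < Suc m"
    then show "(\<Sum>i<n. (q(m := u)) j i * (q(m := u)) k i) = (if j = k then 1 else 0)"
      by (auto simp: less_Suc_eq on uu qu uq)
  next
    fix j i assume "j < Suc m" "i < n"
    have "(\<Sum>k<Suc m. (q(m := u)) k i * R' k j) = (\<Sum>k<m. q k i * R' k j) + u i * R' m j"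
      by simp
    also have "\<dots> = a j i"
      using \<open>j < Suc m\<close> \<open>i < n\<close> am[of i] a[of j i] R(2)[of j m]
      by (cases "j = m") (auto simp: R'_def mult.commute)
    finally show "a j i = (\<Sum>k<Suc m. (q(m := u)) k i * R' k j)" by simp
  next
    fix j assume "j < Suc m"
    then show "0 \<le> R' j j" using R \<open>0 \<le> c\<close> by (auto simp: R'_def less_Suc_eq)
  next
    fix j k assume "j < Suc m" "j < k"
    then show "R' k j = 0" using R by (auto simp: R'_def less_Suc_eq)
  qed
qed

text \<open>The hypothesis \<open>m \<le> n\<close> is where the bound of \<open>2 * r + 1\<close>
  by the numbers of interfaces and of moments enters the existence of the augmented bases.\<close>

lemma QR_exists:
  fixes A :: "real mat"
  assumes A: "A \<in> carrier_mat n m" and "m \<le> n"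
  shows "\<exists>Q R. is_QR A Q R \<and> (\<forall>j<m. 0 \<le> R $$ (j, j))"
proof -
  from gram_schmidt_functions[OF \<open>m \<le> n\<close>, of "\<lambda>j i. A $$ (i, j)"] obtain q R
    where raw: "\<forall>j<m. \<forall>k<m. (\<Sum>i<n. q j i * q k i) = (if j = k then 1 else 0)"
    "\<forall>j<m. \<forall>i<n. A $$ (i, j) = (\<Sum>k<m. q k i * R k j)"
    "\<forall>j<m. 0 \<le> R j j \<and> (\<forall>k. j < k \<longrightarrow> R k j = (0::real))" by (elim exE conjE)
  have on: "(\<Sum>i<n. q j i * q k i) = (if j = k then 1 else 0)" if "j < m" "k < m" for j k
    using raw(1) that by blast
  have a: "A $$ (i, j) = (\<Sum>k<m. q k i * R k j)" if "j < m" "i < n" for j i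
    using raw(2) that by blast
  have R: "0 \<le> R j j" "j < k \<Longrightarrow> R k j = 0" if "j < m" for j k
    using raw(3) that by blast+
  have "is_QR A (mat n m (\<lambda>(i, j). q j i)) (mat m m (\<lambda>(k, j). R k j))"
    unfolding is_QR_def orthonormal_cols_def
  proof (intro conjI)
    show "transpose_mat (mat n m (\<lambda>(i, j). q j i)) * mat n m (\<lambda>(i, j). q j i)
        = 1\<^sub>m (dim_col (mat n m (\<lambda>(i, j). q j i)))"
      by (rule eq_matI) (auto simp: scalar_prod_def on atLeast0LessThan)
    show "A = mat n m (\<lambda>(i, j). q j i) * mat m m (\<lambda>(k, j). R k j)"
      by (rule eq_matI) (use A a in \<open>auto simp: scalar_prod_def atLeast0LessThan\<close>)
  qed (use A R in auto)
  then show ?thesis using R(1) by fastforce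
qed

section \<open>Matrix algebra\<close>

lemma index_outer [simp]:
  "i < dim_vec u \<Longrightarrow> j < dim_vec v \<Longrightarrow> outer u v $$ (i, j) = u $ i * v $ j"
  by (simp add: outer_def)

lemma dim_outer [simp]: "dim_row (outer u v) = dim_vec u" "dim_col (outer u v) = dim_vec v"
  by (simp_all add: outer_def)

lemma index_mult_sum:
  fixes A B :: "real mat"
  assumes "A \<in> carrier_mat n m" "B \<in> carrier_mat m k" "i < n" "j < k"
  shows "(A * B) $$ (i, j) = (\<Sum>l<m. A $$ (i, l) * B $$ (l, j))"
  using assms by (simp add: scalar_prod_def atLeast0LessThan)

lemma mult_outer:
  assumes "dim_col A = dim_vec u"
  shows "A * outer u v = outer (A *\<^sub>v u) v"
  using assms by (intro eq_matI) (auto simp: scalar_prod_def sum_distrib_left mult_ac)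

lemma dim_append_cols [simp]: "dim_row (append_cols A B) = dim_row A"
  "dim_col (append_cols A B) = dim_col A + dim_col B"
  by (simp_all add: append_cols_def)

lemma dim_col_mat [simp]: "dim_row (col_mat v) = dim_vec v" "dim_col (col_mat v) = 1"
  by (simp_all add: col_mat_def)

lemma dim_col_block [simp]: "dim_row (col_block k m A) = dim_row A" "dim_col (col_block k m A) = m"
  by (simp_all add: col_block_def)

lemma dim_D_minus [simp]: "dim_row (D_minus P X) = dim_row X" "dim_col (D_minus P X) = dim_col X"
  by (simp_all add: D_minus_def)

lemma dim_D_plus [simp]: "dim_row (D_plus P X) = dim_row X" "dim_col (D_plus P X) = dim_col X"
  by (simp_all add: D_plus_def)

lemma mat_diag_mult_vec:
  fixes v :: "real vec"
  assumes "v \<in> carrier_vec n"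
  shows "mat_diag n d *\<^sub>v v = vec n (\<lambda>i. d i * v $ i)"
  using assms by (intro eq_vecI) (auto simp: mat_diag_def scalar_prod_def if_distrib[of "\<lambda>x. x * _"] cong: if_cong)

text \<open>The K-, L- and Galerkin equations share this shape once \<epsilon> = 0: the time
  difference and the transport term are multiplied by zero, and a balance between the source
  \<open>C\<close> and the absorption \<open>D\<close> remains.\<close>

lemma scaled_zero_eq_iff:
  fixes A :: "real mat"
  assumes "A \<in> carrier_mat n m" "B \<in> carrier_mat n m" "C \<in> carrier_mat n m" "D \<in> carrier_mat n m"
  shows "0 \<cdot>\<^sub>m A = (- 0) \<cdot>\<^sub>m B - C - D \<longleftrightarrow> D = - C"
proof
  assume eq: "0 \<cdot>\<^sub>m A = (- 0) \<cdot>\<^sub>m B - C - D"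
  show "D = - C"
  proof (rule eq_matI)
    fix i j assume "i < dim_row (- C)" "j < dim_col (- C)"
    then show "D $$ (i, j) = (- C) $$ (i, j)"
      using assms arg_cong[OF eq, of "\<lambda>M. M $$ (i, j)"] by auto
  qed (use assms in auto)
next
  assume "D = - C"
  then show "0 \<cdot>\<^sub>m A = (- 0) \<cdot>\<^sub>m B - C - D"
    by (intro eq_matI) (use assms in auto)
qed

lemma orthonormal_cols_mult_vec_eq_0:
  assumes X: "X \<in> carrier_mat n m" "orthonormal_cols X" and v: "v \<in> carrier_vec m"
    and "X *\<^sub>v v = 0\<^sub>v n"
  shows "v = 0\<^sub>v m"
proof -
  have "v = (transpose_mat X * X) *\<^sub>v v" using X v by (simp add: orthonormal_cols_def)
  also have "\<dots> = transpose_mat X *\<^sub>v (X *\<^sub>v v)"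
    by (rule assoc_mult_mat_vec) (use X v in auto)
  finally show ?thesis using assms by auto
qed

text \<open>The weighted Gram matrix G is positive definite: v . G v is the sum of the
  \<open>d i\<close> times the squared entries of X v, so G v = 0 forces X v = 0 and then v = 0 by
  orthonormality. The left inverse serves two purposes, existence in the L-step and uniqueness in
  the Galerkin step.\<close>

lemma weighted_gram_inverse:
  fixes X :: "real mat"
  assumes X: "X \<in> carrier_mat n m" "orthonormal_cols X" and d: "\<And>i. i < n \<Longrightarrow> 0 < d i"
  shows "\<exists>H \<in> carrier_mat m m. H * (transpose_mat X * mat_diag n d * X) = 1\<^sub>m m"
proof -
  let ?G = "transpose_mat X * mat_diag n d * X"
  have G: "?G \<in> carrier_mat m m" by (rule mult_carrier_mat[of _ m n], rule mult_carrier_mat[of _ m n]) (use X in auto)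
  have inj: "v = 0\<^sub>v m" if v: "v \<in> carrier_vec m" and 0: "?G *\<^sub>v v = 0\<^sub>v m" for v
  proof -
    let ?w = "X *\<^sub>v v"
    have w: "?w \<in> carrier_vec n" using X v by simp
    have "transpose_mat X * mat_diag n d * X *\<^sub>v v = transpose_mat X * mat_diag n d *\<^sub>v ?w"
      by (rule assoc_mult_mat_vec[of _ m n]) (use X v in auto)
    also have "\<dots> = transpose_mat X *\<^sub>v (mat_diag n d *\<^sub>v ?w)"
      by (rule assoc_mult_mat_vec[of _ m n _ n]) (use X v w in auto)
    finally have "transpose_mat X *\<^sub>v (mat_diag n d *\<^sub>v ?w) = 0\<^sub>v m" using 0 by simp
    then have "v \<bullet> (transpose_mat X *\<^sub>v (mat_diag n d *\<^sub>v ?w)) = 0" using v by simp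
    moreover have "v \<bullet> (transpose_mat X *\<^sub>v (mat_diag n d *\<^sub>v ?w)) = ?w \<bullet> (mat_diag n d *\<^sub>v ?w)"
      using transpose_vec_mult_scalar[OF X(1) v, of "mat_diag n d *\<^sub>v ?w"] 
        comm_scalar_prod[of v m "transpose_mat X *\<^sub>v (mat_diag n d *\<^sub>v ?w)"]
        comm_scalar_prod[of ?w n "mat_diag n d *\<^sub>v ?w"] X v w
      by (auto simp: mat_diag_mult_vec)
    ultimately have "(\<Sum>i<n. d i * (?w $ i)\<^sup>2) = 0"
      by (simp add: mat_diag_mult_vec[OF w] scalar_prod_def atLeast0LessThan power2_eq_square mult_ac
          del: index_mult_mat_vec)
    then have "\<forall>i\<in>{..<n}. d i * (?w $ i)\<^sup>2 = 0"
      by (subst (asm) sum_nonneg_eq_0_iff) (use d in \<open>auto simp: less_imp_le simp del: index_mult_mat_vec\<close>)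
    then have zero: "d i * (?w $ i)\<^sup>2 = 0" if "i < n" for i using that by blast
    have "?w $ i = 0" if "i < n" for i
      using zero[OF that] d[OF that] by (simp del: index_mult_mat_vec)
    then have "?w = 0\<^sub>v n" using X by (intro eq_vecI) (auto simp del: index_mult_mat_vec)
    then show ?thesis using orthonormal_cols_mult_vec_eq_0 X v by blast
  qed
  then have "Determinant.det ?G \<noteq> 0"
    using det_0_iff_vec_prod_zero_field[OF G] by blast
  \<comment> \<open>A nonzero determinant makes G a unit of the matrix ring; \<open>()\<close>
    merely fills the record extension of \<open>ring_mat\<close>.\<close>
  from det_non_zero_imp_unit[OF G this, of "()"] show ?thesis
    unfolding Units_def ring_mat_def by auto
qed

section \<open>The scheme in the limit\<close>

lemma sigma_mat_carrier [simp]: "sigma_mat P \<in> carrier_mat (faces P) (faces P)"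
  by (simp add: sigma_mat_def)

lemma dim_sigma_mat [simp]: "dim_row (sigma_mat P) = faces P" "dim_col (sigma_mat P) = faces P"
  by (simp_all add: sigma_mat_def mat_diag_def)

lemma dim_angular [simp]:
  "dim_row (A_plus P) = moments P" "dim_col (A_plus P) = moments P"
  "dim_row (A_minus P) = moments P" "dim_col (A_minus P) = moments P"
  by (simp_all add: A_plus_def A_minus_def T_mat_def M_mat_def absM_mat_def mat_diag_def)

lemma dim_vecs [simp]: "dim_vec (b_vec P) = moments P" "dim_vec (y_vec P T) = faces P"
  "dim_vec (s_vec P h T) = faces P"
  by (simp_all add: b_vec_def y_vec_def s_vec_def)

lemma gamma1_pos [simp]: "0 < gamma1" "gamma1 \<noteq> 0" and gamma1_square: "gamma1 * gamma1 = 2 / 3"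
  by (simp_all add: gamma1_def)

lemma sqrt_b_vec: "1 \<le> moments P \<Longrightarrow> sqrt (b_vec P \<bullet> b_vec P) = gamma1"
  by (simp add: b_vec_def real_sqrt_mult less_imp_le)

text \<open>The vector y is built as the leading part of the source divided by the absorption
  coefficient, so multiplication by \<open>sigma_mat\<close> restores that part; the remaining part
  of the source carries a factor \<epsilon> squared. This identity is what makes y the right vector
  to add to the spatial basis.\<close>

lemma s_vec_eps_0:
  assumes "eps P = 0" "\<And>i. i < faces P \<Longrightarrow> 0 < sigma_face P i"
  shows "s_vec P h T = sigma_mat P *\<^sub>v y_vec P T"
proof -
  have "sigma_mat P *\<^sub>v y_vec P T = vec (faces P) (\<lambda>i. sigma_face P i * y_vec P T $ i)"
    unfolding sigma_mat_def by (rule mat_diag_mult_vec) (simp add: carrier_vecI)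
  also have "\<dots> = s_vec P h T"
  proof (rule eq_vecI)
    fix i assume "i < dim_vec (s_vec P h T)"
    then have "i < faces P" by simp
    have "y_face P T i = inverse (sigma_face P i) * (rad P * light P * Psi_face P T i * delta0 P T i)"
      by (simp add: y_face_def delta0_def algebra_simps diff_divide_distrib)
    with assms(2)[OF \<open>i < faces P\<close>] \<open>i < faces P\<close> show "vec (faces P) (\<lambda>i. sigma_face P i * y_vec P T $ i) $ i = s_vec P h T $ i"
      by (simp add: s_vec_def y_vec_def assms(1))
  qed simp
  finally show ?thesis by simp
qed

section \<open>Solvability of the microscopic substeps at \<epsilon> = 0\<close>

text \<open>Here \<open>P\<close> is the record in which \<open>eps\<close> has already been
  replaced by 0. Such a record violates \<open>valid_params\<close>, so positivity of the absorption
  at the interfaces is an assumption of its own.\<close>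

locale limit_step =
  fixes P :: bug_params and r :: nat and X S V :: "real mat" and h T :: "nat \<Rightarrow> real"
  assumes eps: "eps P = 0"
    and sigma: "\<And>i. i < faces P \<Longrightarrow> 0 < sigma_face P i"
    and low_rank: "low_rank P r X S V"
begin

lemma rank [simp]: "2 * r + 1 \<le> faces P" "2 * r + 1 \<le> moments P" "1 \<le> moments P" "0 < moments P"
  and carriers [simp]: "X \<in> carrier_mat (faces P) r" "S \<in> carrier_mat r r" "V \<in> carrier_mat (moments P) r"
  and X_on: "orthonormal_cols X"
  using low_rank by (auto simp: low_rank_def)

lemma dims [simp]: "dim_row X = faces P" "dim_col X = r" "dim_row V = moments P" "dim_col V = r"
  "dim_row S = r" "dim_col S = r"
  using carriers by (auto simp del: carriers)

lemma s_vec: "s_vec P h T = sigma_mat P *\<^sub>v y_vec P T"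
  by (rule s_vec_eps_0) (use eps sigma in auto)

text \<open>As the source is the absorption matrix times y, the solution is minus the outer product
  of y with the projection of b onto the current angular basis.\<close>

lemma K_step_exists: "\<exists>K'. K' \<in> carrier_mat (faces P) r \<and> K_step P X S V h T K'"
proof -
  let ?w = "transpose_mat V *\<^sub>v b_vec P"
  let ?K = "- outer (y_vec P T) ?w"
  have "sigma_mat P * ?K = - (sigma_mat P * outer (y_vec P T) ?w)" by simp
  also have "sigma_mat P * outer (y_vec P T) ?w = outer (s_vec P h T) ?w"
    unfolding s_vec by (rule mult_outer) simp
  finally have "sigma_mat P * ?K = - outer (s_vec P h T) ?w" .
  then have "K_step P X S V h T ?K"
    unfolding K_step_def Let_def eps zero_power2 div_0
    by (subst scaled_zero_eq_iff[of _ "faces P" r]) (auto intro!: carrier_matI)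
  then show ?thesis by (auto intro!: exI[of _ ?K] carrier_matI)
qed

text \<open>The unknown is multiplied from the right by the weighted Gram matrix of
  \<open>X\<close>, so the solution is the negative source times the left inverse
  \<open>H\<close>.\<close>

lemma L_step_exists: "\<exists>L'. L' \<in> carrier_mat (moments P) r \<and> L_step P X S V h T L'"
proof -
  let ?G = "transpose_mat X * sigma_mat P * X"
  obtain H where H: "H \<in> carrier_mat r r" "H * ?G = 1\<^sub>m r"
    using weighted_gram_inverse[OF carriers(1) X_on, of "sigma_face P"] sigma
    unfolding sigma_mat_def by blast
  let ?B = "outer (b_vec P) (transpose_mat X *\<^sub>v s_vec P h T)"
  have B: "- ?B \<in> carrier_mat (moments P) r" by (auto intro!: carrier_matI)
  have "- ?B * H * ?G = - ?B * (H * ?G)"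
    by (rule assoc_mult_mat[OF B H(1)]) (auto intro!: carrier_matI)
  also have "\<dots> = - ?B" using H B by simp
  finally obtain L' where L: "L' \<in> carrier_mat (moments P) r" "L' * ?G = - ?B"
    using mult_carrier_mat[OF B H(1)] by blast
  have "L_step P X S V h T L'"
    unfolding L_step_def Let_def eps zero_power2 div_0 using L
    by (subst scaled_zero_eq_iff[of _ "moments P" r]) (auto intro!: carrier_matI)
  with L(1) show ?thesis by blast
qed

lemma augment_X_exists:
  assumes "K' \<in> carrier_mat (faces P) r"
  shows "\<exists>Xh. augment_X P X T K' Xh"
proof -
  let ?A = "append_cols (append_cols (col_mat (y_vec P T)) K') X"
  have A: "?A \<in> carrier_mat (faces P) (2 * r + 1)"
    using assms by (auto intro!: carrier_matI)
  from QR_exists[OF A rank(1)] obtain Q R where "is_QR ?A Q R" by blast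
  then show ?thesis
    using A assms unfolding augment_X_def range_contains_def is_QR_def by (auto intro!: exI[of _ Q])
qed

text \<open>A QR decomposition of the augmented matrix almost suffices. Triangularity of
  \<open>R\<close> makes b a multiple \<open>R $$ (0, 0)\<close> of the first column of
  \<open>Q\<close>; comparing norms determines this factor up to sign, and nonnegativity of the
  diagonal settles the sign. The first column is therefore b / |b|, as \<open>augment_V\<close>
  demands.\<close>

lemma augment_V_exists:
  assumes L: "L' \<in> carrier_mat (moments P) r"
  shows "\<exists>Vh. augment_V P V L' Vh"
proof -
  let ?A = "append_cols (append_cols (col_mat (b_vec P)) L') V"
  let ?m = "2 * r + 1"
  have A: "?A \<in> carrier_mat (moments P) ?m"
    using assms by (auto intro!: carrier_matI)
  from QR_exists[OF A rank(2)] obtain Q R where QR: "is_QR ?A Q R"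
    and "\<forall>j<?m. 0 \<le> R $$ (j, j)" by blast
  then have R0: "0 \<le> R $$ (0, 0)" by simp
  have Q: "Q \<in> carrier_mat (moments P) ?m" and R: "R \<in> carrier_mat ?m ?m"
    and on: "transpose_mat Q * Q = 1\<^sub>m ?m" and upper: "upper_triangular R" and eq: "?A = Q * R"
    using QR A L unfolding is_QR_def orthonormal_cols_def by auto
  have b: "b_vec P = R $$ (0, 0) \<cdot>\<^sub>v col Q 0"
  proof (rule eq_vecI)
    fix i assume "i < dim_vec (R $$ (0, 0) \<cdot>\<^sub>v col Q 0)"
    then have i: "i < moments P" using Q by auto
    have "b_vec P $ i = ?A $$ (i, 0)"
      using i L by (simp add: append_cols_def col_mat_def mat_of_cols_index)
    also have "\<dots> = (\<Sum>k<?m. Q $$ (i, k) * R $$ (k, 0))"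
      unfolding eq using i Q R by (simp add: scalar_prod_def atLeast0LessThan)
    also have "\<dots> = (\<Sum>k<?m. if k = 0 then Q $$ (i, 0) * R $$ (0, 0) else 0)"
      by (rule sum.cong) (use upper R in \<open>auto simp: upper_triangular_def\<close>)
    finally show "b_vec P $ i = (R $$ (0, 0) \<cdot>\<^sub>v col Q 0) $ i"
      using i Q by simp
  qed (use Q in auto)
  have "col Q 0 \<bullet> col Q 0 = (transpose_mat Q * Q) $$ (0, 0)" using Q by simp
  also have "\<dots> = 1" by (simp add: on)
  finally have "b_vec P \<bullet> b_vec P = R $$ (0, 0) * R $$ (0, 0)"
    using Q by (simp add: b)
  then have "sqrt (b_vec P \<bullet> b_vec P) = R $$ (0, 0)" using R0 by simp
  then have "R $$ (0, 0) = gamma1" by (simp only: sqrt_b_vec[OF rank(3)])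
  with b have "b_vec P = gamma1 \<cdot>\<^sub>v col Q 0" by simp
  then have "col Q 0 = (1 / sqrt (b_vec P \<bullet> b_vec P)) \<cdot>\<^sub>v b_vec P"
    unfolding sqrt_b_vec[OF rank(3)] by (simp add: smult_smult_assoc)
  moreover have "orthonormal_cols Q" "range_contains Q ?A"
    using QR Q L unfolding is_QR_def range_contains_def by (auto simp: mult_2)
  ultimately show ?thesis using Q unfolding augment_V_def by auto
qed

text \<open>Since b is a positive multiple of the first unit vector, so is the first column of
  \<open>Vh\<close>. Orthogonality to it removes the first entry of every other column: the first
  moment is carried by the first basis vector alone.\<close>

lemma augment_V_entries:
  assumes "augment_V P V L' Vh"
  shows "Vh \<in> carrier_mat (moments P) (2 * r + 1)"
    "\<And>i. i < moments P \<Longrightarrow> Vh $$ (i, 0) = (if i = 0 then 1 else 0)"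
    "\<And>j. j < 2 * r + 1 \<Longrightarrow> Vh $$ (0, j) = (if j = 0 then 1 else 0)"
proof -
  show Vh: "Vh \<in> carrier_mat (moments P) (2 * r + 1)" using assms by (simp add: augment_V_def)
  have on: "transpose_mat Vh * Vh = 1\<^sub>m (2 * r + 1)"
    and c0: "col Vh 0 = (1 / sqrt (b_vec P \<bullet> b_vec P)) \<cdot>\<^sub>v b_vec P"
    using assms Vh by (auto simp: augment_V_def orthonormal_cols_def)
  have u: "col Vh 0 = unit_vec (moments P) 0"
    unfolding c0 sqrt_b_vec[OF rank(3)] by (simp add: b_vec_def smult_smult_assoc)
  show "Vh $$ (i, 0) = (if i = 0 then 1 else 0)" if "i < moments P" for i
    using arg_cong[OF u, of "\<lambda>v. v $ i"] that Vh by simp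
  show "Vh $$ (0, j) = (if j = 0 then 1 else 0)" if j: "j < 2 * r + 1" for j
  proof -
    have "Vh $$ (0, j) = col Vh 0 \<bullet> col Vh j" unfolding u using carrier_matD[OF Vh] j by (subst scalar_prod_left_unit) (auto intro!: carrier_vecI)
    also have "\<dots> = (transpose_mat Vh * Vh) $$ (0, j)" using Vh j by simp
    finally show ?thesis using j by (simp add: on)
  qed
qed

lemma augment_X_range:
  assumes "augment_X P X T K' Xh" "K' \<in> carrier_mat (faces P) r"
  obtains c where "c \<in> carrier_vec (2 * r + 1)" "Xh *\<^sub>v c = y_vec P T"
proof -
  let ?A = "append_cols (append_cols (col_mat (y_vec P T)) K') X"
  from assms obtain C where C: "C \<in> carrier_mat (2 * r + 1) (1 + r + r)" "?A = Xh * C"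
    and Xh: "Xh \<in> carrier_mat (faces P) (2 * r + 1)"
    unfolding augment_X_def range_contains_def by auto
  have "Xh *\<^sub>v col C 0 = col ?A 0" unfolding C(2) using C(1) Xh by simp
  also have "\<dots> = y_vec P T"
    by (rule eq_vecI) (use assms(2) in \<open>auto simp: append_cols_def col_mat_def mat_of_cols_index\<close>)
  moreover have "col C 0 \<in> carrier_vec (2 * r + 1)"
    by (rule carrier_vecI) (use C(1) in simp)
  ultimately show ?thesis using that by simp
qed

text \<open>Write G for the weighted Gram matrix of \<open>Xh\<close> and w for the projection of b
  onto \<open>Vh\<close>. The source is absorption times y = Xh c, so its projection is G c, and the
  equation becomes G Sh = - (G c) w^T. Cancelling the invertible G leaves exactly one
  solution.\<close>

lemma galerkin_step_iff:
  assumes Xh: "augment_X P X T K' Xh" and Vh: "Vh \<in> carrier_mat (moments P) (2 * r + 1)"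
    and c: "c \<in> carrier_vec (2 * r + 1)" "Xh *\<^sub>v c = y_vec P T"
  shows "galerkin_step P X S V h T Xh Vh Sh \<longleftrightarrow> Sh = - outer c (transpose_mat Vh *\<^sub>v b_vec P)"
proof -
  let ?m = "2 * r + 1"
  let ?w = "transpose_mat Vh *\<^sub>v b_vec P"
  let ?G = "transpose_mat Xh * sigma_mat P * Xh"
  have X1: "Xh \<in> carrier_mat (faces P) ?m" "orthonormal_cols Xh"
    using Xh by (auto simp: augment_X_def)
  have G: "?G \<in> carrier_mat ?m ?m" using X1 by (auto intro!: carrier_matI)
  obtain H where H: "H \<in> carrier_mat ?m ?m" "H * ?G = 1\<^sub>m ?m"
    using weighted_gram_inverse[OF X1, of "sigma_face P"] sigma unfolding sigma_mat_def by blast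
  have "?G *\<^sub>v c = transpose_mat Xh * sigma_mat P *\<^sub>v (Xh *\<^sub>v c)"
    by (rule assoc_mult_mat_vec) (use X1 c in auto)
  also have "\<dots> = transpose_mat Xh *\<^sub>v s_vec P h T"
    unfolding c(2) s_vec by (rule assoc_mult_mat_vec) (use X1 in \<open>auto intro!: carrier_vecI\<close>)
  finally have Gc: "?G *\<^sub>v c = transpose_mat Xh *\<^sub>v s_vec P h T" .
  have w: "outer c ?w \<in> carrier_mat ?m ?m" using c Vh by (auto intro!: carrier_matI)
  have "?G * (- outer c ?w) = - (?G * outer c ?w)"
    using X1 c by simp
  also have "?G * outer c ?w = outer (?G *\<^sub>v c) ?w"
    by (rule mult_outer) (use X1 c in auto)
  finally have sol: "?G * (- outer c ?w) = - outer (transpose_mat Xh *\<^sub>v s_vec P h T) ?w"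
    by (simp only: Gc)
  have iff: "galerkin_step P X S V h T Xh Vh Sh \<longleftrightarrow>
      Sh \<in> carrier_mat ?m ?m \<and> ?G * Sh = - outer (transpose_mat Xh *\<^sub>v s_vec P h T) ?w"
  proof (cases "Sh \<in> carrier_mat ?m ?m")
    case True
    then show ?thesis
      unfolding galerkin_step_def Let_def eps zero_power2 div_0 dims using X1 Vh G
      by (subst scaled_zero_eq_iff[of _ ?m ?m]) (auto intro!: carrier_matI simp: L_S_def)
  qed (simp add: galerkin_step_def Let_def)
  show ?thesis
  proof
    assume "galerkin_step P X S V h T Xh Vh Sh"
    with iff sol have Sh: "Sh \<in> carrier_mat ?m ?m" "?G * Sh = ?G * (- outer c ?w)" by auto
    have "Sh = (H * ?G) * Sh" using H Sh by simp
    also have "\<dots> = H * (?G * Sh)" by (rule assoc_mult_mat[OF H(1) G Sh(1)])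
    also have "\<dots> = H * (?G * (- outer c ?w))" by (simp only: Sh)
    also have "\<dots> = (H * ?G) * (- outer c ?w)"
      by (rule assoc_mult_mat[OF H(1) G, symmetric]) (use w in auto)
    also have "\<dots> = - outer c ?w" using H w left_mult_one_mat[of "- outer c ?w" ?m ?m] by simp
    finally show "Sh = - outer c ?w" .
  next
    assume "Sh = - outer c ?w"
    then show "galerkin_step P X S V h T Xh Vh Sh" using iff sol w by auto
  qed
qed

text \<open>Multiplying the Galerkin solution by \<open>Xh\<close> turns c back into y, so the
  choice of spatial basis disappears. The angular factor is a multiple of the first row of
  \<open>Vh\<close>, which has a single nonzero entry, so only the column kept by the truncation
  survives.\<close>

lemma galerkin_step_K_hat:
  assumes Xh: "augment_X P X T K' Xh" and K: "K' \<in> carrier_mat (faces P) r"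
    and Vh: "augment_V P V L' Vh" and Sh: "galerkin_step P X S V h T Xh Vh Sh"
  shows "Xh \<in> carrier_mat (faces P) (2 * r + 1)" "Sh \<in> carrier_mat (2 * r + 1) (2 * r + 1)"
    "\<And>i j. i < faces P \<Longrightarrow> j < 2 * r + 1 \<Longrightarrow>
      (Xh * Sh) $$ (i, j) = (if j = 0 then - gamma1 * y_face P T i else 0)"
proof -
  let ?m = "2 * r + 1"
  show X1: "Xh \<in> carrier_mat (faces P) ?m" and S1: "Sh \<in> carrier_mat ?m ?m"
    using Xh Sh by (auto simp: augment_X_def galerkin_step_def Let_def)
  obtain c where c: "c \<in> carrier_vec ?m" "Xh *\<^sub>v c = y_vec P T"
    using augment_X_range[OF Xh K] by blast
  note V = augment_V_entries[OF Vh]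
  let ?w = "transpose_mat Vh *\<^sub>v b_vec P"
  have "Sh = - outer c ?w" using galerkin_step_iff[OF Xh V(1) c] Sh by blast
  moreover have "Xh * (- outer c ?w) = - (Xh * outer c ?w)"
    using X1 c by simp
  moreover have "Xh * outer c ?w = outer (y_vec P T) ?w"
    using mult_outer[of Xh c ?w] X1 c by auto
  ultimately have KS: "Xh * Sh = - outer (y_vec P T) ?w" by simp
  \<comment> \<open>b is \<open>gamma1\<close> times the first unit vector, so projecting it reads
    off row 0 of \<open>Vh\<close>.\<close>
  have "?w $ j = gamma1 * Vh $$ (0, j)" if "j < ?m" for j
    using that carrier_matD[OF V(1)] by (simp add: b_vec_def)
  then show "(Xh * Sh) $$ (i, j) = (if j = 0 then - gamma1 * y_face P T i else 0)"
    if "i < faces P" "j < ?m" for i j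
    using that V unfolding KS by (auto simp: y_vec_def simp del: index_mult_mat_vec)
qed

end

section \<open>Truncation with vanishing remainder\<close>

lemma zero_of_orthonormal_mult:
  fixes A :: "real mat"
  assumes "Q \<in> carrier_mat n m" "orthonormal_cols Q" "A \<in> carrier_mat m k" "Q * A = 0\<^sub>m n k"
  shows "A = 0\<^sub>m m k"
proof -
  have "A = (transpose_mat Q * Q) * A" using assms by (simp add: orthonormal_cols_def)
  also have "\<dots> = transpose_mat Q * (Q * A)" by (rule assoc_mult_mat) (use assms in auto)
  also have "\<dots> = 0\<^sub>m m k" using assms by simp
  finally show ?thesis .
qed

text \<open>Orthogonality cancels \<open>W\<close> on the right and \<open>U\<close> on the left, so
  the diagonal factor itself is zero.\<close>

lemma SVD_zero:
  assumes "is_SVD n (0\<^sub>m n n) U sv W" "i < n"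
  shows "sv i = 0"
proof -
  have U: "U \<in> carrier_mat n n" "orthonormal_cols U" and W: "W \<in> carrier_mat n n" "orthonormal_cols W"
    and eq: "0\<^sub>m n n = U * mat_diag n sv * transpose_mat W"
    using assms(1) by (auto simp: is_SVD_def)
  have WW: "transpose_mat W * W = 1\<^sub>m n" using W by (simp add: orthonormal_cols_def)
  have "U * mat_diag n sv = U * mat_diag n sv * (transpose_mat W * W)"
    using U WW by (simp add: mat_diag_def)
  also have "\<dots> = U * mat_diag n sv * transpose_mat W * W"
    by (rule assoc_mult_mat[symmetric, of _ n n _ n]) (use U W in auto)
  also have "\<dots> = 0\<^sub>m n n" using W by (simp flip: eq)
  finally have "mat_diag n sv = 0\<^sub>m n n"
    using zero_of_orthonormal_mult[OF U mat_diag_dim] by blast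
  then have "mat_diag n sv $$ (i, i) = 0" using assms(2) by simp
  then show ?thesis using assms(2) by (simp add: mat_diag_def)
qed

text \<open>A zero remainder has a zero triangular factor and hence zero singular values, whatever
  factors \<open>U\<close>, \<open>W\<close> and rank \<open>rs\<close> are chosen. The middle
  factor keeps the single entry of \<open>S_ap\<close>, and the product reduces to the first column
  of \<open>Xh * Sh\<close> times the transposed first column of \<open>Vh\<close>.\<close>

lemma truncation_product:
  assumes tr: "truncation P r Xh Sh Vh r1 X1 S1 V1"
    and Xh: "Xh \<in> carrier_mat n (2 * r + 1)" and Sh: "Sh \<in> carrier_mat (2 * r + 1) (2 * r + 1)"
    and Vh: "Vh \<in> carrier_mat k (2 * r + 1)"
    and rem: "\<And>i j. i < n \<Longrightarrow> 0 < j \<Longrightarrow> j < 2 * r + 1 \<Longrightarrow> (Xh * Sh) $$ (i, j) = 0"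
  shows "X1 * S1 * transpose_mat V1 \<in> carrier_mat n k"
    "\<And>i j. i < n \<Longrightarrow> j < k \<Longrightarrow> (X1 * S1 * transpose_mat V1) $$ (i, j) = (Xh * Sh) $$ (i, 0) * Vh $$ (j, 0)"
proof -
  let ?K_rem = "col_block 1 (2 * r) (Xh * Sh)"
  let ?K_ap = "col_block 0 1 (Xh * Sh)"
  from tr obtain Xh_rem Sh_rem X_ap S_ap U sv W rs R2 where
    rem_QR: "is_QR ?K_rem Xh_rem Sh_rem" and ap_QR: "is_QR ?K_ap X_ap S_ap"
    and svd: "is_SVD (2 * r) Sh_rem U sv W" and rs: "1 \<le> rs" "rs \<le> 2 * r"
    and V1: "V1 = append_cols (col_block 0 1 Vh) (col_block 1 (2 * r) Vh * col_block 0 rs W)"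
    and QR2: "is_QR (append_cols X_ap (Xh_rem * col_block 0 rs U)) X1 R2"
    and S1: "S1 = R2 * four_block_mat S_ap (0\<^sub>m 1 rs) (0\<^sub>m rs 1) (mat_diag rs sv)"
    unfolding truncation_def Let_def by blast
  have "?K_rem = 0\<^sub>m n (2 * r)"
    by (rule eq_matI) (use Xh Sh in \<open>auto simp: col_block_def rem simp del: index_mult_mat(1)\<close>)
  then have "Sh_rem = 0\<^sub>m (2 * r) (2 * r)"
    using rem_QR zero_of_orthonormal_mult[of Xh_rem n "2 * r" Sh_rem "2 * r"] by (auto simp: is_QR_def)
  then have sv: "sv i = 0" if "i < 2 * r" for i using SVD_zero svd that by blast
  have X_ap: "X_ap \<in> carrier_mat n 1" and S_ap: "S_ap \<in> carrier_mat 1 1" and K_ap: "?K_ap = X_ap * S_ap"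
    using ap_QR Xh Sh by (auto simp: is_QR_def)
  let ?Y = "append_cols X_ap (Xh_rem * col_block 0 rs U)"
  let ?F = "four_block_mat S_ap (0\<^sub>m 1 rs) (0\<^sub>m rs 1) (mat_diag rs sv)"
  have Y: "?Y \<in> carrier_mat n (rs + 1)" using X_ap by (auto intro!: carrier_matI)
  have F: "?F \<in> carrier_mat (rs + 1) (rs + 1)" using S_ap by (auto intro!: carrier_matI simp: mat_diag_def)
  have X1: "X1 \<in> carrier_mat n (rs + 1)" and R2: "R2 \<in> carrier_mat (rs + 1) (rs + 1)" and YX: "?Y = X1 * R2"
    using QR2 unfolding is_QR_def carrier_matD[OF Y] by auto
  have V: "V1 \<in> carrier_mat k (rs + 1)" using Vh by (auto simp: V1 intro!: carrier_matI)
  \<comment> \<open>The factor \<open>R2\<close> inside \<open>S1\<close> undoes the last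
    orthonormalization, so the product can be computed from the columns before it.\<close>
  have "X1 * S1 = ?Y * ?F" unfolding S1 YX by (rule assoc_mult_mat[symmetric, OF X1 R2 F])
  moreover have YF: "(?Y * ?F) $$ (i, j) = (if j = 0 then (Xh * Sh) $$ (i, 0) else 0)"
    if "i < n" "j < rs + 1" for i j
  proof -
    have F': "?F $$ (l, j) = (if l = 0 \<and> j = 0 then S_ap $$ (0, 0) else 0)" if "l < rs + 1" for l
      using that \<open>j < rs + 1\<close> rs S_ap sv by (auto simp: mat_diag_def)
    have "(?Y * ?F) $$ (i, j) = (\<Sum>l<rs + 1. ?Y $$ (i, l) * ?F $$ (l, j))"
      by (rule index_mult_sum[OF Y F that])
    also have "\<dots> = (\<Sum>l<rs + 1. if l = 0 then (if j = 0 then X_ap $$ (i, 0) * S_ap $$ (0, 0) else 0) else 0)"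
      by (rule sum.cong) (use F' X_ap that in \<open>auto simp: append_cols_def\<close>)
    also have "\<dots> = (if j = 0 then (X_ap * S_ap) $$ (i, 0) else 0)"
      using that index_mult_sum[OF X_ap S_ap, of i 0] by (simp del: index_mult_mat(1))
    finally show ?thesis
      using that Xh Sh unfolding K_ap[symmetric] by (simp add: col_block_def del: index_mult_mat(1))
  qed
  moreover have V0: "V1 $$ (j, 0) = Vh $$ (j, 0)" if "j < k" for j
    using that Vh by (simp add: V1 append_cols_def col_block_def)
  ultimately show "(X1 * S1 * transpose_mat V1) $$ (i, j) = (Xh * Sh) $$ (i, 0) * Vh $$ (j, 0)"
    if "i < n" "j < k" for i j
  proof -
    have "(X1 * S1 * transpose_mat V1) $$ (i, j)
        = (\<Sum>l<rs + 1. (?Y * ?F) $$ (i, l) * transpose_mat V1 $$ (l, j))"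
      unfolding \<open>X1 * S1 = ?Y * ?F\<close>
      by (rule index_mult_sum) (use that Y F V in auto)
    also have "\<dots> = (\<Sum>l<rs + 1. if l = 0 then (Xh * Sh) $$ (i, 0) * V1 $$ (j, 0) else 0)"
      by (rule sum.cong) (use YF that carrier_matD[OF V] in \<open>auto simp del: index_mult_mat(1)\<close>)
    also have "\<dots> = (Xh * Sh) $$ (i, 0) * V1 $$ (j, 0)" by simp
    finally show ?thesis using V0 that by simp
  qed
  show "X1 * S1 * transpose_mat V1 \<in> carrier_mat n k"
    using X1 V by (auto simp: S1 intro!: carrier_matI)
qed

lemma truncationI:
  assumes "is_QR (col_block 1 (2 * r) (Xh * Sh)) Xh_rem Sh_rem"
    and "is_QR (col_block 0 1 (Xh * Sh)) X_ap S_ap" and "is_SVD (2 * r) Sh_rem U sv W"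
    and "1 \<le> rs" "rs \<le> 2 * r" "sqrt (\<Sum>i\<in>{rs..<2 * r}. (sv i)\<^sup>2) \<le> tol P"
    and "is_QR (append_cols X_ap (Xh_rem * col_block 0 rs U)) X1 R2"
  shows "truncation P r Xh Sh Vh (rs + 1) X1
    (R2 * four_block_mat S_ap (0\<^sub>m 1 rs) (0\<^sub>m rs 1) (mat_diag rs sv))
    (append_cols (col_block 0 1 Vh) (col_block 1 (2 * r) Vh * col_block 0 rs W))"
  using assms unfolding truncation_def Let_def by blast

text \<open>The zero remainder has the trivial singular value decomposition with identity factors.
  The smallest admissible \<open>rs = 1\<close> discards nothing of positive size and so meets any
  nonnegative tolerance; the resulting rank 2 fits because \<open>r \<ge> 1\<close> forces
  \<open>n \<ge> 3\<close>.\<close>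

lemma truncation_exists:
  assumes "1 \<le> r" "2 * r + 1 \<le> n" "0 \<le> tol P"
    and Xh: "Xh \<in> carrier_mat n (2 * r + 1)" and Sh: "Sh \<in> carrier_mat (2 * r + 1) (2 * r + 1)"
    and rem: "\<And>i j. i < n \<Longrightarrow> 0 < j \<Longrightarrow> j < 2 * r + 1 \<Longrightarrow> (Xh * Sh) $$ (i, j) = 0"
  shows "\<exists>r1 X1 S1 V1. truncation P r Xh Sh Vh r1 X1 S1 V1"
proof -
  let ?K_rem = "col_block 1 (2 * r) (Xh * Sh)"
  let ?K_ap = "col_block 0 1 (Xh * Sh)"
  have Kr: "?K_rem \<in> carrier_mat n (2 * r)" and Ka: "?K_ap \<in> carrier_mat n 1"
    using Xh by (auto intro!: carrier_matI)
  obtain X_rem S_rem where rem_QR: "is_QR ?K_rem X_rem S_rem"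
    using QR_exists[OF Kr] assms by auto
  obtain X_ap S_ap where ap_QR: "is_QR ?K_ap X_ap S_ap"
    using QR_exists[OF Ka] assms by auto
  have "?K_rem = 0\<^sub>m n (2 * r)"
    by (rule eq_matI) (use Xh Sh in \<open>auto simp: col_block_def rem simp del: index_mult_mat(1)\<close>)
  then have "S_rem = 0\<^sub>m (2 * r) (2 * r)"
    using rem_QR zero_of_orthonormal_mult[of X_rem n "2 * r" S_rem "2 * r"] by (auto simp: is_QR_def)
  then have svd: "is_SVD (2 * r) S_rem (1\<^sub>m (2 * r)) (\<lambda>_. 0) (1\<^sub>m (2 * r))"
    by (auto simp: is_SVD_def orthonormal_cols_def mat_diag_def intro!: eq_matI)
  let ?Y = "append_cols X_ap (X_rem * col_block 0 1 (1\<^sub>m (2 * r)))"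
  have "?Y \<in> carrier_mat n 2" using ap_QR Ka by (auto simp: is_QR_def intro!: carrier_matI)
  moreover have "2 \<le> n" using assms(1,2) by simp
  ultimately obtain X1 R2 where "is_QR ?Y X1 R2" using QR_exists[of ?Y n 2] by auto
  from truncationI[where P = P and Vh = Vh and rs = 1, OF rem_QR ap_QR svd _ _ _ this] show ?thesis
    using assms(1,3) by auto
qed

section \<open>The macroscopic update and elimination of h\<close>

text \<open>Agreement at the unknown interfaces suffices: the periodic extension reduces indices
  into that range, and the other one takes the value 0 outside it, which scaling preserves.\<close>

lemma D0_scaled:
  assumes "\<And>j. j < faces P \<Longrightarrow> u j = c * v j" "0 < cells P"
  shows "D0 P u i = c * D0 P v i"
proof -
  have "face_ext P u k = c * face_ext P v k" for k
    using assms by (cases "bc P") (auto simp: face_ext_def faces_def nat_less_iff)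
  then show ?thesis by (simp add: D0_def algebra_simps diff_divide_distrib)
qed

text \<open>The temperature equation expresses \<open>kappa P * sigma_cell P i * h' i\<close> as the
  time difference of T, so multiplying the other equation by \<open>kappa P\<close> eliminates h'.
  The flux coefficient becomes kappa gamma1^2 / 2 = kappa / 3; as kappa is nonzero, no information
  is lost.\<close>

lemma macro_update_eps_0:
  assumes "eps P = 0" "0 < cells P" "0 < spec_heat P" "1 \<le> moments P"
    and sigma: "\<And>i. i < cells P \<Longrightarrow> 0 < sigma_cell P i"
    and g: "g' \<in> carrier_mat (faces P) (moments P)"
    "\<And>i. i < faces P \<Longrightarrow> g' $$ (i, 0) = - gamma1 * y_face P T i"
  shows "macro_update P g' h T h' T' \<longleftrightarrow>
    (\<forall>i<cells P. limit_residual P T T' i = 0 \<and> (T' i - T i) / dt P = kappa P * sigma_cell P i * h' i)"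
proof -
  have D: "D0 P (\<lambda>j. (g' *\<^sub>v unit_vec (moments P) 0) $ j) i = - gamma1 * D0 P (y_face P T) i" for i
    by (rule D0_scaled) (use assms in auto)
  have "(eps P)\<^sup>2 / light P * ((h' i - h i) / dt P) + rad P * kappa P * sigma_cell P i * Psi T i * h' i
      + gamma1 / 2 * D0 P (\<lambda>j. (g' *\<^sub>v unit_vec (moments P) 0) $ j) i = - sigma_cell P i * h' i
    \<longleftrightarrow> limit_residual P T T' i = 0"
    if "i < cells P" and T': "(T' i - T i) / dt P = kappa P * sigma_cell P i * h' i" for i
  proof -
    have gam: "gamma1 / 2 * (- gamma1 * d) = - (d / 3)" for d
    proof -
      have "gamma1 / 2 * (- gamma1 * d) = - (gamma1 * gamma1) * d / 2" by simp
      then show ?thesis unfolding gamma1_square by simp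
    qed
    let ?E = "sigma_cell P i * h' i + rad P * kappa P * sigma_cell P i * Psi T i * h' i
      - D0 P (y_face P T) i / 3"
    have "2 / (3 * spec_heat P) = kappa P / 3" "2 * rad P * Psi T i / spec_heat P = rad P * kappa P * Psi T i"
      by (simp_all add: kappa_def)
    then have "limit_residual P T T' i = kappa P * ?E"
      unfolding limit_residual_def T' by (simp only:) (simp add: algebra_simps)
    moreover have "kappa P \<noteq> 0" using assms by (simp add: kappa_def)
    ultimately have "limit_residual P T T' i = 0 \<longleftrightarrow> ?E = 0" by simp
    then show ?thesis unfolding D gam assms(1) zero_power2 div_0 mult_zero_left by linarith
  qed
  then show ?thesis unfolding macro_update_def by blast
qed

section \<open>Positivity of the absorption and the replacement of epsilon\<close>

text \<open>Interface \<open>i\<close> is the right end of cell \<open>i\<close>, so the last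
  periodic interface is \<open>x_hi P\<close> itself; the closed interval in
  \<open>valid_params\<close> covers it.\<close>

lemma x_face_bounds:
  assumes "valid_params P" "i < faces P"
  shows "x_face P i \<in> {x_lo P..x_hi P}"
proof -
  have v: "x_lo P < x_hi P" "1 \<le> cells P" using assms by (auto simp: valid_params_def)
  have i: "Suc i \<le> cells P" using assms(2) by (auto simp: faces_def split: boundary.splits)
  have dx: "0 < dx P" "real (cells P) * dx P = x_hi P - x_lo P" using v by (auto simp: dx_def)
  have "real (Suc i) * dx P \<le> real (cells P) * dx P"
    using i dx by (intro mult_right_mono) (simp_all add: less_imp_le)
  moreover have "0 \<le> real (Suc i) * dx P" using dx by simp
  moreover have "x_face P i = x_lo P + real (Suc i) * dx P" by (simp add: x_face_def add.commute)
  ultimately show ?thesis using dx(2) by simp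
qed

lemma x_cell_bounds:
  assumes "valid_params P" "i < cells P"
  shows "x_cell P i \<in> {x_lo P..x_hi P}"
proof -
  have v: "x_lo P < x_hi P" "1 \<le> cells P" using assms by (auto simp: valid_params_def)
  have dx: "0 < dx P" "real (cells P) * dx P = x_hi P - x_lo P" using v by (auto simp: dx_def)
  have "(real i + 1 / 2) * dx P \<le> real (cells P) * dx P"
    using assms(2) dx by (intro mult_right_mono) (auto simp: less_imp_le)
  moreover have "0 \<le> (real i + 1 / 2) * dx P" using dx by simp
  ultimately show ?thesis using dx(2) by (simp add: x_cell_def)
qed

lemma sigma_pos:
  assumes "valid_params P"
  shows "i < faces P \<Longrightarrow> 0 < sigma_face P i" "i < cells P \<Longrightarrow> 0 < sigma_cell P i"
proof -
  obtain s0 where s0: "0 < s0" "\<forall>x\<in>{x_lo P..x_hi P}. s0 \<le> sigma_a P x"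
    using assms by (auto simp: valid_params_def)
  show "i < faces P \<Longrightarrow> 0 < sigma_face P i"
    using s0(1) bspec[OF s0(2) x_face_bounds[OF assms]] by (fastforce simp: sigma_face_def)
  show "i < cells P \<Longrightarrow> 0 < sigma_cell P i"
    using s0(1) bspec[OF s0(2) x_cell_bounds[OF assms]] by (fastforce simp: sigma_cell_def)
qed

text \<open>These quantities do not involve \<epsilon>. Facts derived from the valid
  \<open>P\<close> can therefore be used for the limit record, which is not valid itself.\<close>

lemma eps_update [simp]:
  "faces (P\<lparr>eps := e\<rparr>) = faces P" "sigma_face (P\<lparr>eps := e\<rparr>) = sigma_face P"
  "sigma_cell (P\<lparr>eps := e\<rparr>) = sigma_cell P" "kappa (P\<lparr>eps := e\<rparr>) = kappa P"
  "low_rank (P\<lparr>eps := e\<rparr>) = low_rank P" "limit_residual (P\<lparr>eps := e\<rparr>) = limit_residual P"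
proof -
  have dx: "dx (P\<lparr>eps := e\<rparr>) = dx P" by (simp add: dx_def)
  show f: "faces (P\<lparr>eps := e\<rparr>) = faces P" by (cases "bc P") (simp_all add: faces_def)
  show s: "sigma_face (P\<lparr>eps := e\<rparr>) = sigma_face P" "sigma_cell (P\<lparr>eps := e\<rparr>) = sigma_cell P"
    "kappa (P\<lparr>eps := e\<rparr>) = kappa P"
    by (simp_all add: fun_eq_iff sigma_face_def sigma_cell_def x_face_def x_cell_def dx kappa_def)
  show "low_rank (P\<lparr>eps := e\<rparr>) = low_rank P" by (simp add: fun_eq_iff low_rank_def f)
  have "y_face (P\<lparr>eps := e\<rparr>) T = y_face P T" for T
    by (simp add: fun_eq_iff y_face_def s Psi_face_def delta0_def dx)
  then show "limit_residual (P\<lparr>eps := e\<rparr>) = limit_residual P"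
    by (cases "bc P") (simp_all add: fun_eq_iff limit_residual_def D0_def face_ext_def f dx)
qed

text \<open>From left to right, every admissible run produces the same first moment. From right to
  left, each substep is shown to be realizable, so the limit scheme has a step to \<open>T'\<close>
  whenever the recursion holds.\<close>

lemma limit_step_iff:
  assumes valid: "valid_params P" and low_rank: "low_rank P r X S V"
  shows "(\<exists>r' X' S' V' h'. bug_step (P\<lparr>eps := 0\<rparr>) r X S V h T r' X' S' V' h' T')
    \<longleftrightarrow> (\<forall>i<cells P. limit_residual P T T' i = 0)"
proof -
  define Q where "Q = P\<lparr>eps := 0\<rparr>"
  have Q: "eps Q = 0" "cells Q = cells P" "spec_heat Q = spec_heat P" "moments Q = moments P"
    "dt Q = dt P" "tol Q = tol P" "limit_residual Q = limit_residual P" "kappa Q = kappa P"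
    "sigma_cell Q = sigma_cell P" by (simp_all add: Q_def)
  interpret limit_step Q r X S V h T
    by unfold_locales (use valid low_rank sigma_pos[OF valid] in \<open>simp_all add: Q_def\<close>)
  have pos: "0 < cells P" "0 < spec_heat P" "0 < dt P" "0 \<le> tol P" "1 \<le> moments P"
    using valid by (auto simp: valid_params_def)
  have "1 \<le> r" using low_rank by (simp add: low_rank_def)
  \<comment> \<open>For arbitrary admissible bases, decompositions and truncation rank, the first
    moment is - gamma1 y. The macroscopic update is thus independent of these choices, and both
    directions rest on this fact.\<close>
  have macro: "macro_update Q (X' * S' * transpose_mat V') h T h' T' \<longleftrightarrow>
      (\<forall>i<cells P. limit_residual P T T' i = 0 \<and> (T' i - T i) / dt P = kappa P * sigma_cell P i * h' i)"
    if K: "K' \<in> carrier_mat (faces Q) r" and Xh: "augment_X Q X T K' Xh" and Vh: "augment_V Q V L' Vh"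
      and Sh: "galerkin_step Q X S V h T Xh Vh Sh" and tr: "truncation Q r Xh Sh Vh r' X' S' V'"
    for K' Xh L' Vh Sh r' X' S' V' h'
  proof -
    note G = galerkin_step_K_hat[OF Xh K Vh Sh]
    note V = augment_V_entries[OF Vh]
    have 0: "(Xh * Sh) $$ (i, j) = 0" if "i < faces Q" "0 < j" "j < 2 * r + 1" for i j
      using G(3)[of i j] that by simp
    note g = truncation_product[OF tr G(1,2) V(1) 0]
    have "(X' * S' * transpose_mat V') $$ (i, 0) = - gamma1 * y_face Q T i" if "i < faces Q" for i
    proof -
      have "(X' * S' * transpose_mat V') $$ (i, 0) = (Xh * Sh) $$ (i, 0) * Vh $$ (0, 0)"
        by (rule g(2)) (use that in simp_all)
      then show ?thesis using G(3)[of i 0] V(2)[of 0] that by simp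
    qed
    then show ?thesis
      using macro_update_eps_0[of Q "X' * S' * transpose_mat V'" T h h' T'] g(1) pos sigma_pos[OF valid]
      by (simp add: Q)
  qed
  show ?thesis
    unfolding Q_def[symmetric]
  proof
    assume "\<exists>r' X' S' V' h'. bug_step Q r X S V h T r' X' S' V' h' T'"
    then obtain r' X' S' V' h' K' Xh L' Vh Sh where
      K: "K_step Q X S V h T K'" and Xh: "augment_X Q X T K' Xh" and Vh: "augment_V Q V L' Vh"
      and Sh: "galerkin_step Q X S V h T Xh Vh Sh" and tr: "truncation Q r Xh Sh Vh r' X' S' V'"
      and m: "macro_update Q (X' * S' * transpose_mat V') h T h' T'"
      unfolding bug_step_def by blast
    have "K' \<in> carrier_mat (faces Q) r" using K by (simp add: K_step_def Let_def)
    from macro[OF this Xh Vh Sh tr] m show "\<forall>i<cells P. limit_residual P T T' i = 0" by blast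
  next
    assume res: "\<forall>i<cells P. limit_residual P T T' i = 0"
    obtain K' where K: "K' \<in> carrier_mat (faces Q) r" "K_step Q X S V h T K'"
      using K_step_exists by blast
    obtain L' where L: "L' \<in> carrier_mat (moments Q) r" "L_step Q X S V h T L'"
      using L_step_exists by blast
    obtain Xh where Xh: "augment_X Q X T K' Xh" using augment_X_exists[OF K(1)] by blast
    obtain Vh where Vh: "augment_V Q V L' Vh" using augment_V_exists[OF L(1)] by blast
    obtain c where c: "c \<in> carrier_vec (2 * r + 1)" "Xh *\<^sub>v c = y_vec Q T"
      using augment_X_range[OF Xh K(1)] by blast
    obtain Sh where Sh: "galerkin_step Q X S V h T Xh Vh Sh"
      using galerkin_step_iff[OF Xh augment_V_entries(1)[OF Vh] c] by blast
    note G = galerkin_step_K_hat[OF Xh K(1) Vh Sh]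
    have 0: "(Xh * Sh) $$ (i, j) = 0" if "i < faces Q" "0 < j" "j < 2 * r + 1" for i j
      using G(3)[of i j] that by simp
    have "0 \<le> tol Q" using pos by (simp add: Q)
    from truncation_exists[OF \<open>1 \<le> r\<close> rank(1) this G(1,2) 0]
    obtain r' X' S' V' where tr: "truncation Q r Xh Sh Vh r' X' S' V'" by blast
    \<comment> \<open>The temperature equation dictates this value; the divisor is nonzero by
      positivity of kappa and of the absorption.\<close>
    define h' where "h' i = (T' i - T i) / dt P / (kappa P * sigma_cell P i)" for i
    have "kappa P \<noteq> 0" using pos by (simp add: kappa_def)
    then have "(T' i - T i) / dt P = kappa P * sigma_cell P i * h' i" if "i < cells P" for i
      using sigma_pos(2)[OF valid that] by (simp add: h'_def)
    with res have "macro_update Q (X' * S' * transpose_mat V') h T h' T'"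
      using macro[OF K(1) Xh Vh Sh tr] by blast
    with K L Xh Vh Sh tr show "\<exists>r' X' S' V' h'. bug_step Q r X S V h T r' X' S' V' h' T'"
      unfolding bug_step_def by blast
  qed
qed

section \<open>Consistency\<close>

text \<open>The partial derivatives are the total derivative applied to (1, 0) and (0, 1). The
  first-order ones are continuous because they are differentiable again; continuity of
  \<open>Txx\<close> is part of the C^2 hypothesis.\<close>

lemma Ck_on_2_partials:
  fixes T :: "real \<times> real \<Rightarrow> real"
  assumes "Ck_on 2 T U"
  obtains Tt Tx Txx where "continuous_on U T" "continuous_on U Tt" "continuous_on U Tx" "continuous_on U Txx"
    "\<And>t x. (t, x) \<in> U \<Longrightarrow> ((\<lambda>s. T (s, x)) has_real_derivative Tt (t, x)) (at t)"
    "\<And>t x. (t, x) \<in> U \<Longrightarrow> ((\<lambda>y. T (t, y)) has_real_derivative Tx (t, x)) (at x)"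
    "\<And>t x. (t, x) \<in> U \<Longrightarrow> ((\<lambda>y. Tx (t, y)) has_real_derivative Txx (t, x)) (at x)"
proof -
  have partial_t: "((\<lambda>s. f (s, x)) has_real_derivative D (1, 0)) (at t)"
    if "(f has_derivative D) (at (t, x))" for f :: "real \<times> real \<Rightarrow> real" and D t x
  proof -
    have "((\<lambda>s. (s, x)) has_derivative (\<lambda>h. (h, 0))) (at t)"
      by (auto intro!: derivative_eq_intros)
    from has_derivative_compose[OF this, of f D] that
    have "((\<lambda>s. f (s, x)) has_derivative (\<lambda>h. D (h, 0))) (at t)" by simp
    moreover have "D (h, 0) = D (1, 0) * h" for h
      using linear_cmul[OF has_derivative_linear[OF that], of h "(1, 0)"] by (simp add: mult.commute)
    then have "(\<lambda>h. D (h, 0)) = (*) (D (1, 0))" by (rule ext)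
    ultimately show ?thesis by (simp only: has_field_derivative_def)
  qed
  have partial_x: "((\<lambda>y. f (t, y)) has_real_derivative D (0, 1)) (at x)"
    if "(f has_derivative D) (at (t, x))" for f :: "real \<times> real \<Rightarrow> real" and D t x
  proof -
    have "((\<lambda>y. (t, y)) has_derivative (\<lambda>h. (0, h))) (at x)"
      by (auto intro!: derivative_eq_intros)
    from has_derivative_compose[OF this, of f D] that
    have "((\<lambda>y. f (t, y)) has_derivative (\<lambda>h. D (0, h))) (at x)" by simp
    moreover have "D (0, h) = D (0, 1) * h" for h
      using linear_cmul[OF has_derivative_linear[OF that], of h "(0, 1)"] by (simp add: mult.commute)
    then have "(\<lambda>h. D (0, h)) = (*) (D (0, 1))" by (rule ext)
    ultimately show ?thesis by (simp only: has_field_derivative_def)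
  qed
  from assms obtain D where D: "\<And>p. p \<in> U \<Longrightarrow> (T has_derivative D p) (at p)"
    and D1: "\<And>v. Ck_on (Suc 0) (\<lambda>p. D p v) U" by (auto simp: numeral_2_eq_2)
  from D1[of "(0, 1)"] obtain E where E: "\<And>p. p \<in> U \<Longrightarrow> ((\<lambda>p. D p (0, 1)) has_derivative E p) (at p)"
    and E0: "\<And>v. continuous_on U (\<lambda>p. E p v)" by auto
  have cont: "continuous_on U f" if "\<And>p. p \<in> U \<Longrightarrow> (f has_derivative F p) (at p)"
    for f :: "real \<times> real \<Rightarrow> real" and F
    using that by (meson continuous_at_imp_continuous_on has_derivative_continuous)
  from D1[of "(1, 0)"] obtain G where G: "\<And>p. p \<in> U \<Longrightarrow> ((\<lambda>p. D p (1, 0)) has_derivative G p) (at p)"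
    by auto
  show ?thesis
  proof (rule that)
    show "continuous_on U T" by (rule cont[OF D])
    show "continuous_on U (\<lambda>p. D p (1, 0))" by (rule cont[OF G])
    show "continuous_on U (\<lambda>p. D p (0, 1))" by (rule cont[OF E])
    show "continuous_on U (\<lambda>p. E p (0, 1))" by (rule E0)
  next
    fix t x assume "(t, x) \<in> U"
    then show "((\<lambda>s. T (s, x)) has_real_derivative D (t, x) (1, 0)) (at t)"
      "((\<lambda>y. T (t, y)) has_real_derivative D (t, x) (0, 1)) (at x)"
      "((\<lambda>y. D (t, y) (0, 1)) has_real_derivative E (t, x) (0, 1)) (at x)"
      by (rule partial_t[OF D] partial_x[OF D] partial_x[OF E])+
  qed
qed

lemma Ck_on_1_derivative:
  fixes f :: "real \<Rightarrow> real"
  assumes "Ck_on 1 f U"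
  obtains f' where "continuous_on U f" "continuous_on U f'"
    "\<And>x. x \<in> U \<Longrightarrow> (f has_real_derivative f' x) (at x)"
proof -
  from assms obtain D where D: "\<And>x. x \<in> U \<Longrightarrow> (f has_derivative D x) (at x)"
    and D0: "\<And>v. continuous_on U (\<lambda>x. D x v)" by auto
  have "(f has_real_derivative D x 1) (at x)" if "x \<in> U" for x
  proof -
    have "D x h = D x 1 * h" for h
      using linear_cmul[OF has_derivative_linear[OF D[OF that]], of h 1] by (simp add: mult.commute)
    then have "D x = (*) (D x 1)" by (rule ext)
    then show ?thesis using D[OF that] by (simp only: has_field_derivative_def)
  qed
  moreover have "continuous_on U f"
    using D by (meson continuous_at_imp_continuous_on has_derivative_continuous)
  ultimately show ?thesis using D0[of 1] that by blast
qed

text \<open>The discrete flux difference is the derivative of the flux formula with every function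
  evaluated at its own intermediate point; only second derivatives of \<open>u\<close> are needed.\<close>

lemma flux_difference_mean_value:
  fixes u v w s s' :: "real \<Rightarrow> real"
  assumes "0 < h"
    and u: "\<forall>y\<in>{x - h..x + h}. (u has_real_derivative v y) (at y)"
    and v: "\<forall>y\<in>{x - h..x + h}. (v has_real_derivative w y) (at y)"
    and s: "\<forall>y\<in>{x - h..x + h}. (s has_real_derivative s' y) (at y)"
    and s0: "\<forall>y\<in>{x - h..x + h}. s y \<noteq> 0"
  shows "\<exists>\<xi> \<alpha> \<beta> \<eta> \<zeta>. {\<xi>, \<alpha>, \<beta>, \<eta>, \<zeta>} \<subseteq> {x - h..x + h} \<and>
    (inverse (s (x + h / 2)) * ((4 * u x ^ 3 + 4 * u (x + h) ^ 3) / 2) * ((u (x + h) - u x) / h)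
     - inverse (s (x - h / 2)) * ((4 * u (x - h) ^ 3 + 4 * u x ^ 3) / 2) * ((u x - u (x - h)) / h)) / h
    = - (s' \<xi> / (s \<xi>)\<^sup>2) * (2 * u \<alpha> ^ 3 + 2 * u \<beta> ^ 3) * v \<eta>
      + inverse (s \<xi>) * (6 * u \<alpha> ^ 2 * v \<alpha> + 6 * u \<beta> ^ 2 * v \<beta>) * v \<eta>
      + inverse (s \<xi>) * (2 * u \<alpha> ^ 3 + 2 * u \<beta> ^ 3) * w \<zeta>"
proof -
  note u = u[rule_format] and v = v[rule_format] and s = s[rule_format] and s0 = s0[rule_format]
  \<comment> \<open>\<open>J m\<close> is the numerical flux centred at \<open>m\<close>, with
    \<open>m\<close> moving continuously between the two interfaces x - h/2 and x + h/2, where it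
    takes the values that occur in the scheme. Its derivative \<open>J'\<close> still contains two
    difference quotients.\<close>
  define J where "J m = inverse (s m) * (2 * u (m - h / 2) ^ 3 + 2 * u (m + h / 2) ^ 3)
    * ((u (m + h / 2) - u (m - h / 2)) / h)" for m
  define J' where "J' m = - (s' m / (s m)\<^sup>2) * (2 * u (m - h / 2) ^ 3 + 2 * u (m + h / 2) ^ 3)
      * ((u (m + h / 2) - u (m - h / 2)) / h)
    + inverse (s m) * (6 * u (m - h / 2) ^ 2 * v (m - h / 2) + 6 * u (m + h / 2) ^ 2 * v (m + h / 2))
      * ((u (m + h / 2) - u (m - h / 2)) / h)
    + inverse (s m) * (2 * u (m - h / 2) ^ 3 + 2 * u (m + h / 2) ^ 3)
      * ((v (m + h / 2) - v (m - h / 2)) / h)" for m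
  have J: "(J has_real_derivative J' m) (at m)" if m: "x - h / 2 \<le> m" "m \<le> x + h / 2" for m
  proof -
    have up: "((\<lambda>m. f (m + h / 2)) has_real_derivative f' (m + h / 2)) (at m)"
      if "\<And>y. y \<in> {x - h..x + h} \<Longrightarrow> (f has_real_derivative f' y) (at y)" for f f'
      using that[of "m + h / 2"] m by (simp add: DERIV_shift)
    have um: "((\<lambda>m. f (m - h / 2)) has_real_derivative f' (m - h / 2)) (at m)"
      if "\<And>y. y \<in> {x - h..x + h} \<Longrightarrow> (f has_real_derivative f' y) (at y)" for f f'
      using that[of "m - h / 2"] m by (simp add: DERIV_shift[of f _ m "- (h / 2)", simplified])
    have "(s has_real_derivative s' m) (at m)" "s m \<noteq> 0"
      using s[of m] s0[of m] m \<open>0 < h\<close> by auto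
    then have S: "((\<lambda>m. inverse (s m)) has_real_derivative - (s' m / (s m)\<^sup>2)) (at m)"
      by (auto intro!: derivative_eq_intros simp: power2_eq_square divide_inverse)
    have A: "((\<lambda>m. 2 * u (m - h / 2) ^ 3 + 2 * u (m + h / 2) ^ 3) has_real_derivative
        6 * u (m - h / 2) ^ 2 * v (m - h / 2) + 6 * u (m + h / 2) ^ 2 * v (m + h / 2)) (at m)"
      by (rule derivative_eq_intros up[OF u] um[OF u] refl | assumption)+ simp
    have B: "((\<lambda>m. (u (m + h / 2) - u (m - h / 2)) / h) has_real_derivative
        (v (m + h / 2) - v (m - h / 2)) / h) (at m)"
      by (intro DERIV_cdivide DERIV_diff up[OF u] um[OF u])
    show ?thesis unfolding J_def J'_def
      using DERIV_mult[OF DERIV_mult[OF S A] B] by (simp add: algebra_simps)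
  qed
  \<comment> \<open>The mean value theorem for \<open>J\<close> yields \<xi>. Two further
    applications around \<xi> replace the remaining quotients by \<open>v \<eta>\<close> and
    \<open>w \<zeta>\<close>; the points \<alpha> and \<beta> are \<xi> - h/2 and \<xi> +
    h/2.\<close>
  have "\<exists>\<xi>. x - h / 2 < \<xi> \<and> \<xi> < x + h / 2
    \<and> J (x + h / 2) - J (x - h / 2) = (x + h / 2 - (x - h / 2)) * J' \<xi>"
    by (rule MVT2) (use \<open>0 < h\<close> J in auto)
  then obtain \<xi> where \<xi>: "x - h / 2 < \<xi>" "\<xi> < x + h / 2" "(J (x + h / 2) - J (x - h / 2)) / h = J' \<xi>"
    using \<open>0 < h\<close> by auto
  have "\<exists>\<eta>. \<xi> - h / 2 < \<eta> \<and> \<eta> < \<xi> + h / 2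
    \<and> u (\<xi> + h / 2) - u (\<xi> - h / 2) = (\<xi> + h / 2 - (\<xi> - h / 2)) * v \<eta>"
    by (rule MVT2) (use \<open>0 < h\<close> \<xi> in \<open>auto intro!: u\<close>)
  then obtain \<eta> where \<eta>: "\<xi> - h / 2 < \<eta>" "\<eta> < \<xi> + h / 2" "(u (\<xi> + h / 2) - u (\<xi> - h / 2)) / h = v \<eta>"
    using \<open>0 < h\<close> by auto
  have "\<exists>\<zeta>. \<xi> - h / 2 < \<zeta> \<and> \<zeta> < \<xi> + h / 2
    \<and> v (\<xi> + h / 2) - v (\<xi> - h / 2) = (\<xi> + h / 2 - (\<xi> - h / 2)) * w \<zeta>"
    by (rule MVT2) (use \<open>0 < h\<close> \<xi> in \<open>auto intro!: v\<close>)
  then obtain \<zeta> where \<zeta>: "\<xi> - h / 2 < \<zeta>" "\<zeta> < \<xi> + h / 2" "(v (\<xi> + h / 2) - v (\<xi> - h / 2)) / h = w \<zeta>"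
    using \<open>0 < h\<close> by auto
  have "(J (x + h / 2) - J (x - h / 2)) / h =
     - (s' \<xi> / (s \<xi>)\<^sup>2) * (2 * u (\<xi> - h / 2) ^ 3 + 2 * u (\<xi> + h / 2) ^ 3) * v \<eta>
      + inverse (s \<xi>) * (6 * u (\<xi> - h / 2) ^ 2 * v (\<xi> - h / 2) + 6 * u (\<xi> + h / 2) ^ 2 * v (\<xi> + h / 2)) * v \<eta>
      + inverse (s \<xi>) * (2 * u (\<xi> - h / 2) ^ 3 + 2 * u (\<xi> + h / 2) ^ 3) * w \<zeta>"
    unfolding \<xi>(3) J'_def \<eta>(3) \<zeta>(3) ..
  moreover have "J (x + h / 2) = inverse (s (x + h / 2)) * ((4 * u x ^ 3 + 4 * u (x + h) ^ 3) / 2) * ((u (x + h) - u x) / h)"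
    "J (x - h / 2) = inverse (s (x - h / 2)) * ((4 * u (x - h) ^ 3 + 4 * u x ^ 3) / 2) * ((u x - u (x - h)) / h)"
    by (simp_all add: J_def distrib_left add.commute add_divide_distrib)
  moreover have "{\<xi>, \<xi> - h / 2, \<xi> + h / 2, \<eta>, \<zeta>} \<subseteq> {x - h..x + h}"
    using \<xi> \<eta> \<zeta> \<open>0 < h\<close> by auto
  ultimately show ?thesis
    by (intro exI[of _ \<xi>] exI[of _ "\<xi> - h / 2"] exI[of _ "\<xi> + h / 2"] exI[of _ \<eta>] exI[of _ \<zeta>]) simp
qed

section \<open>Uniform consistency in interior cells\<close>

lemma dist_Pair_le: "dist (a, b) (c, d) \<le> dist a c + dist b d"
  by (simp add: dist_Pair_Pair sqrt_sum_squares_le_sum)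

text \<open>Under the bound on \<open>k\<close>, both interfaces of cell \<open>Suc k\<close> are
  unknowns for either boundary condition, also for \<open>Zero\<close>, where
  \<open>faces P = cells P - 1\<close>. The boundary condition thus drops out of the interior
  residual.\<close>

lemma D0_interior:
  assumes "Suc (Suc k) < cells P"
  shows "D0 P u (Suc k) = (u (Suc k) - u k) / dx P"
proof -
  have "int (Suc k) mod int (cells P) = int (Suc k)" "int k mod int (cells P) = int k"
    using assms by auto
  then show ?thesis
    using assms by (auto simp: D0_def face_ext_def faces_def nat_add_distrib split: boundary.split)
qed

lemma y_face_interior:
  assumes "Suc k < cells P"
  shows "y_face P T k = rad P * light P * (inverse (sigma_face P k) *
    ((4 * T k ^ 3 + 4 * T (Suc k) ^ 3) / 2) * ((T (Suc k) - T k) / dx P))"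
proof -
  have "delta0 P (\<lambda>j. rad P * light P * T j) k = rad P * light P * ((T (Suc k) - T k) / dx P)"
    using assms by (simp add: delta0_def right_diff_distrib diff_divide_distrib)
  then show ?thesis using assms by (simp add: y_face_def Psi_face_def Psi_def)
qed

lemma limit_residual_consistent:
  assumes valid: "valid_params P"
  shows "consistent_with_diffusion P limit_residual"
  unfolding consistent_with_diffusion_def
proof (intro impI allI)
  fix T :: "real \<times> real \<Rightarrow> real" and t0 t1 e :: real
  define I where "I = {x_lo P..x_hi P}"
  define K where "K = {t0..t1}"
  assume "smooth_near (sigma_a P) {x_lo P..x_hi P}"
  then obtain V where V: "I \<subseteq> V" "Ck_on 1 (sigma_a P) V"
    unfolding smooth_near_def I_def by blast
  from Ck_on_1_derivative[OF V(2)] obtain s' where cs: "continuous_on V (sigma_a P)" "continuous_on V s'"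
    and s': "\<And>x. x \<in> V \<Longrightarrow> (sigma_a P has_real_derivative s' x) (at x)" by blast
  assume "smooth_near T ({t0..t1} \<times> {x_lo P..x_hi P})"
  then obtain U where U: "open U" "K \<times> I \<subseteq> U" "Ck_on 2 T U"
    unfolding smooth_near_def I_def K_def by blast
  from Ck_on_2_partials[OF U(3)] obtain Tt Tx Txx where
    cT: "continuous_on U T" "continuous_on U Tt" "continuous_on U Tx" "continuous_on U Txx"
    and Tt: "\<And>t x. (t, x) \<in> U \<Longrightarrow> ((\<lambda>s. T (s, x)) has_real_derivative Tt (t, x)) (at t)"
    and Tx: "\<And>t x. (t, x) \<in> U \<Longrightarrow> ((\<lambda>y. T (t, y)) has_real_derivative Tx (t, x)) (at x)"
    and Txx: "\<And>t x. (t, x) \<in> U \<Longrightarrow> ((\<lambda>y. Tx (t, y)) has_real_derivative Txx (t, x)) (at x)"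
    by blast
  have KI: "(t, x) \<in> U" if "t \<in> K" "x \<in> I" for t x using that U by blast
  have s0: "sigma_a P x \<noteq> 0" if "x \<in> I" for x
    using valid that unfolding valid_params_def I_def by fastforce
  have "spec_heat P \<noteq> 0" using valid by (simp add: valid_params_def)
  assume "0 < e"
  \<comment> \<open>Each factor gets its own argument: \<open>t'\<close> for the time derivative and
    the Greek points for the flux. Mean value points give the discrete residual; setting
    \<open>t' = t\<close> and all Greek points to \<open>x\<close> gives that of the differential
    equation.\<close>
  define Res where "Res t t' x \<xi> \<alpha> \<beta> \<eta> \<zeta> =
    (1 + 2 * rad P * (4 * T (t, x) ^ 3) / spec_heat P) * Tt (t', x)
    - 2 * rad P * light P / (3 * spec_heat P) *
      (- (s' \<xi> / (sigma_a P \<xi>)\<^sup>2) * (2 * T (t, \<alpha>) ^ 3 + 2 * T (t, \<beta>) ^ 3) * Tx (t, \<eta>)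
      + inverse (sigma_a P \<xi>) * (6 * T (t, \<alpha>) ^ 2 * Tx (t, \<alpha>) + 6 * T (t, \<beta>) ^ 2 * Tx (t, \<beta>)) * Tx (t, \<eta>)
      + inverse (sigma_a P \<xi>) * (2 * T (t, \<alpha>) ^ 3 + 2 * T (t, \<beta>) ^ 3) * Txx (t, \<zeta>))"
    for t t' x \<xi> \<alpha> \<beta> \<eta> \<zeta>
  define B where "B = K \<times> K \<times> I \<times> I \<times> I \<times> I \<times> I \<times> I"
  define F where "F = (\<lambda>(t, t', x, \<xi>, \<alpha>, \<beta>, \<eta>, \<zeta>). Res t t' x \<xi> \<alpha> \<beta> \<eta> \<zeta>)"
  have comp_T: "continuous_on B (\<lambda>p. g (f1 p, f2 p))"
    if "continuous_on U g" "continuous_on B f1" "continuous_on B f2" "f1 ` B \<subseteq> K" "f2 ` B \<subseteq> I"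
    for f1 f2 :: "_ \<Rightarrow> real" and g :: "real \<times> real \<Rightarrow> real"
    by (rule continuous_on_compose2[OF that(1)]) (use that KI in \<open>auto intro!: continuous_on_Pair\<close>)
  have comp_s: "continuous_on B (\<lambda>p. g (f p))"
    if "continuous_on V g" "continuous_on B f" "f ` B \<subseteq> I" for f :: "_ \<Rightarrow> real" and g :: "real \<Rightarrow> real"
    by (rule continuous_on_compose2[OF that(1)]) (use that V in auto)
  \<comment> \<open>The divisions are harmless because the absorption coefficient does not vanish on
    \<open>I\<close>.\<close>
  have "continuous_on B F"
    unfolding F_def Res_def case_prod_beta
    by (intro continuous_intros comp_T[OF cT(1)] comp_T[OF cT(2)] comp_T[OF cT(3)] comp_T[OF cT(4)]
      comp_s[OF cs(1)] comp_s[OF cs(2)]) (auto simp: B_def s0 \<open>spec_heat P \<noteq> 0\<close>)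
  moreover have "compact B" by (auto simp: B_def K_def I_def intro!: compact_Times)
  ultimately have "uniformly_continuous_on B F" by (rule compact_uniformly_continuous)
  then obtain d where "0 < d" and d: "\<And>p q. p \<in> B \<Longrightarrow> q \<in> B \<Longrightarrow> dist q p < d \<Longrightarrow> dist (F q) (F p) < e"
    using \<open>0 < e\<close> unfolding uniformly_continuous_on_def by metis
  show "\<exists>d>0. \<forall>\<tau> n t i. let Q = P\<lparr>cells := n, dt := \<tau>\<rparr> in
    0 < \<tau> \<longrightarrow> \<tau> < d \<longrightarrow> dx Q < d \<longrightarrow> t0 \<le> t \<longrightarrow> t + \<tau> \<le> t1 \<longrightarrow> 0 < i \<longrightarrow> Suc i < n \<longrightarrow>
    \<bar>limit_residual Q (\<lambda>j. T (t, x_cell Q j)) (\<lambda>j. T (t + \<tau>, x_cell Q j)) i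
      - diffusion_residual P T t (x_cell Q i)\<bar> < e"
    unfolding Let_def
  proof (intro exI[of _ "d / 8"] conjI allI impI)
    \<comment> \<open>The two points to be compared differ in six coordinates, one by less than
      \<tau> and five by at most h, so a bound d/8 on both step sizes keeps their distance below
      d.\<close>
    show "0 < d / 8" using \<open>0 < d\<close> by simp
    fix \<tau> t :: real and n i :: nat
    define Q where "Q = P\<lparr>cells := n, dt := \<tau>\<rparr>"
    define h where "h = dx Q"
    define x where "x = x_cell Q i"
    assume asm: "0 < \<tau>" "\<tau> < d / 8" "dx (P\<lparr>cells := n, dt := \<tau>\<rparr>) < d / 8" "t0 \<le> t" "t + \<tau> \<le> t1"
      "0 < i" "Suc i < n"
    have sel: "rad Q = rad P" "light Q = light P" "spec_heat Q = spec_heat P" "sigma_a Q = sigma_a P"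
      "dt Q = \<tau>" "cells Q = n" "x_lo Q = x_lo P" "x_hi Q = x_hi P" by (simp_all add: Q_def)
    have "x_lo P < x_hi P" using valid by (simp add: valid_params_def)
    then have h: "0 < h" "h < d / 8" "real n * h = x_hi P - x_lo P"
      using asm by (auto simp: h_def dx_def sel simp flip: Q_def)
    obtain k where i: "i = Suc k" using \<open>0 < i\<close> by (cases i) auto
    have cell: "x_cell Q (Suc i) = x + h" "x_cell Q k = x - h"
      "sigma_face Q i = sigma_a P (x + h / 2)" "sigma_face Q k = sigma_a P (x - h / 2)"
      by (simp_all add: x_def h_def x_cell_def x_face_def sigma_face_def sel i algebra_simps)
    \<comment> \<open>The conditions \<open>0 < i\<close> and \<open>Suc i < n\<close> keep both
      neighbouring midpoints inside the domain, so all mean value points lie in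
      \<open>I\<close>.\<close>
    have "0 \<le> (real i - 1 / 2) * h" using h \<open>0 < i\<close> by simp
    then have "x_lo P \<le> x - h" by (simp add: x_def h_def x_cell_def sel algebra_simps)
    have "(real i + 3 / 2) * h \<le> real n * h"
      using h \<open>Suc i < n\<close> by (intro mult_right_mono) auto
    moreover have "x + h = x_lo P + (real i + 3 / 2) * h"
      by (simp add: x_def x_cell_def sel algebra_simps flip: h_def)
    ultimately have "x + h \<le> x_hi P" using h(3) by linarith
    with \<open>x_lo P \<le> x - h\<close> have sub: "{x - h..x + h} \<subseteq> I" by (auto simp: I_def)
    have "x \<in> I" using sub h by auto
    have "t \<in> K" using asm by (auto simp: K_def)
    have "\<exists>s. t < s \<and> s < t + \<tau> \<and> T (t + \<tau>, x) - T (t, x) = (t + \<tau> - t) * Tt (s, x)"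
      by (rule MVT2) (use asm \<open>x \<in> I\<close> in \<open>auto intro!: Tt KI simp: K_def\<close>)
    then obtain s where s: "t < s" "s < t + \<tau>" "(T (t + \<tau>, x) - T (t, x)) / \<tau> = Tt (s, x)"
      using asm by auto
    have "s \<in> K" using s asm by (auto simp: K_def)
    let ?flux = "(inverse (sigma_a P (x + h / 2)) * ((4 * T (t, x) ^ 3 + 4 * T (t, x + h) ^ 3) / 2) * ((T (t, x + h) - T (t, x)) / h)
       - inverse (sigma_a P (x - h / 2)) * ((4 * T (t, x - h) ^ 3 + 4 * T (t, x) ^ 3) / 2) * ((T (t, x) - T (t, x - h)) / h)) / h"
    have near: "y \<in> I" "(t, y) \<in> U" "y \<in> V" if "y \<in> {x - h..x + h}" for y
      using that sub KI \<open>t \<in> K\<close> V by auto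
    have "\<forall>y\<in>{x - h..x + h}. ((\<lambda>y. T (t, y)) has_real_derivative Tx (t, y)) (at y)"
      "\<forall>y\<in>{x - h..x + h}. ((\<lambda>y. Tx (t, y)) has_real_derivative Txx (t, y)) (at y)"
      "\<forall>y\<in>{x - h..x + h}. (sigma_a P has_real_derivative s' y) (at y)"
      "\<forall>y\<in>{x - h..x + h}. sigma_a P y \<noteq> 0"
      using near Tx Txx s' s0 by blast+
    from flux_difference_mean_value[OF h(1) this]
    obtain \<xi> \<alpha> \<beta> \<eta> \<zeta> where pts: "{\<xi>, \<alpha>, \<beta>, \<eta>, \<zeta>} \<subseteq> {x - h..x + h}" and flux:
      "?flux
      = - (s' \<xi> / (sigma_a P \<xi>)\<^sup>2) * (2 * T (t, \<alpha>) ^ 3 + 2 * T (t, \<beta>) ^ 3) * Tx (t, \<eta>)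
      + inverse (sigma_a P \<xi>) * (6 * T (t, \<alpha>) ^ 2 * Tx (t, \<alpha>) + 6 * T (t, \<beta>) ^ 2 * Tx (t, \<beta>)) * Tx (t, \<eta>)
      + inverse (sigma_a P \<xi>) * (2 * T (t, \<alpha>) ^ 3 + 2 * T (t, \<beta>) ^ 3) * Txx (t, \<zeta>)"
      by (elim exE conjE)
    have "limit_residual Q (\<lambda>j. T (t, x_cell Q j)) (\<lambda>j. T (t + \<tau>, x_cell Q j)) i
      = (1 + 2 * rad P * (4 * T (t, x) ^ 3) / spec_heat P) * Tt (s, x)
        - 2 / (3 * spec_heat P) * (rad P * light P * ?flux)"
    proof -
      have "D0 Q (y_face Q (\<lambda>j. T (t, x_cell Q j))) i = rad P * light P * ?flux"
        using asm(7) by (simp add: i D0_interior y_face_interior sel cell[unfolded i]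
          right_diff_distrib diff_divide_distrib flip: x_def[unfolded i] h_def)
      then show ?thesis
        by (simp add: limit_residual_def Psi_def sel s(3) flip: x_def)
    qed
    also have "\<dots> = F (t, s, x, \<xi>, \<alpha>, \<beta>, \<eta>, \<zeta>)"
      unfolding F_def Res_def flux by simp
    finally have lhs: "limit_residual Q (\<lambda>j. T (t, x_cell Q j)) (\<lambda>j. T (t + \<tau>, x_cell Q j)) i
      = F (t, s, x, \<xi>, \<alpha>, \<beta>, \<eta>, \<zeta>)" .
    have rhs: "diffusion_residual P T t x = F (t, t, x, x, x, x, x, x)"
    proof -
      have txU: "(t, x) \<in> U" using KI \<open>t \<in> K\<close> \<open>x \<in> I\<close> by blast
      have xV: "x \<in> V" using V \<open>x \<in> I\<close> by blast
      \<comment> \<open>The inner \<open>deriv\<close> is differentiated once more, so it must equal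
        \<open>Tx\<close> on a whole neighbourhood of \<open>x\<close>; the open slice of
        \<open>U\<close> provides one.\<close>
      have "open {y. (t, y) \<in> U}"
        using open_vimage[OF U(1), of "Pair t"] by (simp add: vimage_def continuous_intros)
      \<comment> \<open>The coefficients 4 and 12 match \<open>Res\<close> at \<alpha> = \<beta> =
        x, where the halves 2 + 2 and 6 + 6 coincide.\<close>
      have "((\<lambda>y. 1 / sigma_a P y * (4 * T (t, y) ^ 3) * Tx (t, y)) has_real_derivative
          - (s' x / (sigma_a P x)\<^sup>2) * (4 * T (t, x) ^ 3) * Tx (t, x)
          + 1 / sigma_a P x * (12 * T (t, x) ^ 2 * Tx (t, x)) * Tx (t, x)
          + 1 / sigma_a P x * (4 * T (t, x) ^ 3) * Txx (t, x)) (at x)" (is "(_ has_real_derivative ?D) _")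
      proof -
        have S: "((\<lambda>y. 1 / sigma_a P y) has_real_derivative - (s' x / (sigma_a P x)\<^sup>2)) (at x)"
          using s'[OF xV] s0[OF \<open>x \<in> I\<close>] by (auto intro!: derivative_eq_intros simp: power2_eq_square)
        have A: "((\<lambda>y. 4 * T (t, y) ^ 3) has_real_derivative 12 * T (t, x) ^ 2 * Tx (t, x)) (at x)"
          by (rule derivative_eq_intros Tx[OF txU] refl)+ simp
        show ?thesis using DERIV_mult[OF DERIV_mult[OF S A] Txx[OF txU]] by (simp add: algebra_simps)
      qed
      then have "((\<lambda>y. 1 / sigma_a P y * (4 * T (t, y) ^ 3) * deriv (\<lambda>z. T (t, z)) y)
          has_real_derivative ?D) (at x)"
        by (rule has_field_derivative_transform_within_open[OF _ \<open>open {y. (t, y) \<in> U}\<close>])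
          (use txU DERIV_imp_deriv[OF Tx] in auto)
      then show ?thesis
        using DERIV_imp_deriv[OF Tt[OF txU]]
        by (simp add: diffusion_residual_def DERIV_imp_deriv F_def Res_def inverse_eq_divide)
    qed
    have "dist (F (t, s, x, \<xi>, \<alpha>, \<beta>, \<eta>, \<zeta>)) (F (t, t, x, x, x, x, x, x)) < e"
    proof (rule d)
      show "(t, t, x, x, x, x, x, x) \<in> B" "(t, s, x, \<xi>, \<alpha>, \<beta>, \<eta>, \<zeta>) \<in> B"
        using \<open>t \<in> K\<close> \<open>s \<in> K\<close> \<open>x \<in> I\<close> pts sub by (auto simp: B_def)
      have "dist (t, s, x, \<xi>, \<alpha>, \<beta>, \<eta>, \<zeta>) (t, t, x, x, x, x, x, x)
        \<le> dist t t + (dist s t + (dist x x + (dist \<xi> x + (dist \<alpha> x + (dist \<beta> x + (dist \<eta> x + dist \<zeta> x))))))"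
        by (intro order_trans[OF dist_Pair_le] add_left_mono order_refl)
      also have "\<dots> < d" using pts s asm(1,2) h by (auto simp: dist_real_def)
      finally show "dist (t, s, x, \<xi>, \<alpha>, \<beta>, \<eta>, \<zeta>) (t, t, x, x, x, x, x, x) < d" .
    qed
    then show "\<bar>limit_residual (P\<lparr>cells := n, dt := \<tau>\<rparr>) (\<lambda>j. T (t, x_cell (P\<lparr>cells := n, dt := \<tau>\<rparr>) j))
        (\<lambda>j. T (t + \<tau>, x_cell (P\<lparr>cells := n, dt := \<tau>\<rparr>) j)) i
      - diffusion_residual P T t (x_cell (P\<lparr>cells := n, dt := \<tau>\<rparr>) i)\<bar> < e"
      by (simp add: lhs rhs dist_real_def flip: Q_def x_def)
  qed
qed

theorem theorem6:
  fixes P :: bug_params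
  assumes "valid_params P"
  shows
    "(\<forall>r X S V h T T'. low_rank P r X S V \<longrightarrow>
        ((\<exists>r' X' S' V' h'. bug_step (P\<lparr>eps := 0\<rparr>) r X S V h T r' X' S' V' h' T')
          \<longleftrightarrow> (\<forall>i<cells P. limit_residual P T T' i = 0)))
     \<and> consistent_with_diffusion P limit_residual"
proof (intro conjI allI impI)
  fix r X S V h T T'
  assume "low_rank P r X S V"
  with assms show "(\<exists>r' X' S' V' h'. bug_step (P\<lparr>eps := 0\<rparr>) r X S V h T r' X' S' V' h' T')
      \<longleftrightarrow> (\<forall>i<cells P. limit_residual P T T' i = 0)"
    by (rule limit_step_iff)
qed (rule limit_residual_consistent[OF assms])

end
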